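(* For every $w\in\{0,1\}^\omega$ the following are equivalent: (i) $w$ computes a positive inversion of every total computable $f:\{0,1\}^\omega\to\{0,1\}^\omega$ with $\mu(f(\{0,1\}^\omega))>0$; (ii) $w$ computes a probabilistic inversion of every total computable $f:\{0,1\}^\omega\to\{0,1\}^\omega$ with $\mu(f(\{0,1\}^\omega))>0$; (iii) $\emptyset'\leq_T w$.
   Context: Reals are elements of $\{0,1\}^\omega$ and $\mu$ is the uniform measure. $\emptyset'$ is the halting problem and $\leq_T$ is Turing reducibility. For reals $x,y$, $x\oplus y$ is the real $z$ with $z(2n)=x(n)$, $z(2n+1)=y(n)$. A partial function $g:\subseteq\{0,1\}^\omega\to\{0,1\}^\omega$ is partial $w$-computable ("$w$ computes $g$") if there is an oracle Turing functional $\Phi$ such that for every $x$: $x\in\mathrm{dom}(g)$ iff $\Phi^{x\oplus w}(n)\downarrow$ for all $n$; and if $x\in\mathrm{dom}(g)$ then $\Phi^{x\oplus w}(n)=g(x)(n)$ for all $n$. Total computable means computable without additional oracle and defined on all of $\{0,1\}^\omega$. A partial function $g$ is a positive inversion of $f$ if $\mu(\{y: f(g(y))=y\})>0$, and a probabilistic inversion of $f$ if $\mu(\{y\oplus r: f(g(y\oplus r))=y\})>0$ (the equations include the assertion that the terms are defined). *)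

theory Defs
  imports "HOL-Probability.Probability" "HOL-Library.Nat_Bijection"
begin

type_synonym cantor = "nat \<Rightarrow> bool"

text \<open>The uniform measure. Every set measured below is Borel: the image of a total computable
  function is compact, and partial computable functions have Borel domains and are continuous on
  them. So the convention that non-measurable sets get measure 0 plays no role.\<close>

definition uniform :: "cantor measure" where
  "uniform = PiM UNIV (\<lambda>_. measure_pmf (bernoulli_pmf (1/2)))"

definition join :: "cantor \<Rightarrow> cantor \<Rightarrow> cantor" (infixl "\<squnion>\<^sub>T" 65) where
  "x \<squnion>\<^sub>T y = (\<lambda>n. if even n then x (n div 2) else y (n div 2))"

text \<open>Oracle Turing functionals are presented as Kleene's partial recursive functionals: the
  programs are the unary partial recursive functions relative to an oracle, where several arguments
  are packed into one number by the Cantor pairing \<open>prod_encode\<close>. The identity is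
  \<open>Tuple Fst Snd\<close>.\<close>

datatype program =
    Zero
  | Succ
  | Fst
  | Snd
  | Query
  | Tuple program program
  | Compose program program
  | Prim_Rec program program
  | Minimize program

text \<open>\<open>run X p n\<close> is the value of program \<open>p\<close> with oracle \<open>X\<close> on input \<open>n\<close>, and \<open>None\<close> if the
  computation diverges. Minimisation searches upwards and diverges if one of the values it needs
  before the first zero is undefined.\<close>

primrec run :: "cantor \<Rightarrow> program \<Rightarrow> nat \<Rightarrow> nat option" where
  "run X Zero = (\<lambda>n. Some 0)"
| "run X Succ = (\<lambda>n. Some (Suc n))"
| "run X Fst = (\<lambda>n. Some (fst (prod_decode n)))"
| "run X Snd = (\<lambda>n. Some (snd (prod_decode n)))"
| "run X Query = (\<lambda>n. Some (of_bool (X n)))"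
| "run X (Tuple p q) =
    (\<lambda>n. Option.bind (run X p n) (\<lambda>a. Option.bind (run X q n) (\<lambda>b. Some (prod_encode (a, b)))))"
| "run X (Compose p q) = (\<lambda>n. Option.bind (run X q n) (run X p))"
| "run X (Prim_Rec p q) = (\<lambda>n. case prod_decode n of (a, k) \<Rightarrow>
    rec_nat (run X p a)
      (\<lambda>i r. Option.bind r (\<lambda>v. run X q (prod_encode (a, prod_encode (i, v))))) k)"
| "run X (Minimize p) = (\<lambda>n.
    if \<exists>m. run X p (prod_encode (n, m)) = Some 0 \<and>
           (\<forall>k<m. run X p (prod_encode (n, k)) \<noteq> None)
    then Some (LEAST m. run X p (prod_encode (n, m)) = Some 0)
    else None)"

primrec program_code :: "program \<Rightarrow> nat" where
  "program_code Zero = 0"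
| "program_code Succ = 1"
| "program_code Fst = 2"
| "program_code Snd = 3"
| "program_code Query = 4"
| "program_code (Tuple p q) = 5 + 4 * prod_encode (program_code p, program_code q)"
| "program_code (Compose p q) = 6 + 4 * prod_encode (program_code p, program_code q)"
| "program_code (Prim_Rec p q) = 7 + 4 * prod_encode (program_code p, program_code q)"
| "program_code (Minimize p) = 8 + 4 * program_code p"

lemma program_code_inject: "program_code p = program_code q \<longleftrightarrow> p = q"
proof (induction p arbitrary: q)
  case (Tuple p1 p2) then show ?case by (cases q; simp; presburger)
next
  case (Compose p1 p2) then show ?case by (cases q; simp; presburger)
next
  case (Prim_Rec p1 p2) then show ?case by (cases q; simp; presburger)
next
  case (Minimize p) then show ?case by (cases q; simp; presburger)
qed (case_tac q; simp)+

definition halting_problem :: cantor where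
  "halting_problem e \<longleftrightarrow> (\<exists>p. program_code p = e \<and> run (\<lambda>_. False) p e \<noteq> None)"

definition turing_reducible :: "cantor \<Rightarrow> cantor \<Rightarrow> bool" (infix "\<le>\<^sub>T" 50) where
  "x \<le>\<^sub>T w \<longleftrightarrow> (\<exists>p. \<forall>n. run w p n = Some (of_bool (x n)))"

text \<open>A partial function \<open>g\<close> on Cantor space has value \<open>None\<close> outside its domain.\<close>

definition computes :: "cantor \<Rightarrow> (cantor \<Rightarrow> cantor option) \<Rightarrow> bool" where
  "computes w g \<longleftrightarrow> (\<exists>p. \<forall>x.
     (x \<in> dom g \<longleftrightarrow> (\<forall>n. run (x \<squnion>\<^sub>T w) p n \<noteq> None)) \<and>
     (\<forall>y. g x = Some y \<longrightarrow> (\<forall>n. run (x \<squnion>\<^sub>T w) p n = Some (of_bool (y n)))))"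

definition total_computable :: "(cantor \<Rightarrow> cantor) \<Rightarrow> bool" where
  "total_computable f \<longleftrightarrow> (\<exists>p. \<forall>x n. run x p n = Some (of_bool (f x n)))"

definition positive_inversion ::
    "(cantor \<Rightarrow> cantor) \<Rightarrow> (cantor \<Rightarrow> cantor option) \<Rightarrow> bool" where
  "positive_inversion f g \<longleftrightarrow>
     measure uniform {y. \<exists>x. g y = Some x \<and> f x = y} > 0"

definition probabilistic_inversion ::
    "(cantor \<Rightarrow> cantor) \<Rightarrow> (cantor \<Rightarrow> cantor option) \<Rightarrow> bool" where
  "probabilistic_inversion f g \<longleftrightarrow>
     measure uniform {y \<squnion>\<^sub>T r | y r. \<exists>x. g (y \<squnion>\<^sub>T r) = Some x \<and> f x = y} > 0"

end

theory Submission imports Defs begin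

text \<open>A positive inversion of \<open>f\<close> becomes a probabilistic one by ignoring the random bits, because
\<open>y \<squnion>\<^sub>T r \<mapsto> y\<close> preserves the uniform measure. The content of the theorem lies in the other two
implications, and both rest on one tool, Kleene's normal form (\<open>run_iff_derives\<close>): a computation
converges if and only if a finite table of input-output claims certifies it, the number coding the
table bounds every oracle query mentioned in it, and checking a table is computable. Computations can
therefore be run on finite strings instead of reals, and measures of the resulting clopen sets
become cardinalities of finite sets of strings.

Probabilistic inversions compute the halting problem. A single function suffices
(\<open>puzzle\<close>). Read the argument as two reals \<open>y\<close> and \<open>z\<close>; output \<open>y\<close>, except
that bit \<open>\<langle>n, s\<rangle>\<close> is replaced by \<open>z(n)\<close> if \<open>n\<close> enters the halting problem at
stage \<open>s\<close>. The function is onto, but to invert it one has to put into \<open>z(n)\<close> the bit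
\<open>y(\<langle>n, s\<rangle>)\<close>. An inverter that commits itself to \<open>z(n)\<close> after reading only \<open>u\<close>
bits of its input is right with probability one half if \<open>s\<close> is so large that the bit has not been read.
Choose a cylinder in which the inverter is right with conditional probability above 3/4
(\<open>dense_cylinder\<close>). With the oracle \<open>w\<close> one can search for a \<open>u\<close> such that the inverter
has committed itself on more than half of the cylinder, and then \<open>n\<close> cannot enter the
halting problem much later than at stage \<open>u\<close>.

The halting problem inverts. Let \<open>f\<close> be given by a program. The images under \<open>f\<close> of the
cylinders are decreasing intersections of clopen sets, uniformly in the cylinder. The halting problem
decides, for each cylinder, from which stage on the measure of these clopen sets drops by less than a
prescribed small amount. Taking the clopen set at that stage in place of the image misleads only about
few \<open>y\<close>: the errors over all cylinders add up to less than the measure of the range. For every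
\<open>y\<close> in the range about which no cylinder misleads, the leftmost path through the cylinders
whose images contain \<open>y\<close> is computed bit by bit, and it is a preimage of \<open>y\<close>
(\<open>preimage_correct\<close>).\<close>

section \<open>Functions computable relative to a family of oracles\<close>

abbreviation pfst :: "nat \<Rightarrow> nat" where "pfst n \<equiv> fst (prod_decode n)"
abbreviation psnd :: "nat \<Rightarrow> nat" where "psnd n \<equiv> snd (prod_decode n)"

text \<open>One program has to work for all oracles \<open>X i\<close> of the family at once. Indexing by reals gives
functionals of a real argument, for instance with \<open>X y = y \<squnion>\<^sub>T w\<close>; indexing by the type
\<open>unit\<close> gives computability relative to a single oracle.\<close>

definition computable :: "('i \<Rightarrow> cantor) \<Rightarrow> ('i \<Rightarrow> nat \<Rightarrow> nat) \<Rightarrow> bool" where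
  "computable X F \<longleftrightarrow> (\<exists>p. \<forall>i n. run (X i) p n = Some (F i n))"

definition decidable :: "('i \<Rightarrow> cantor) \<Rightarrow> ('i \<Rightarrow> nat \<Rightarrow> bool) \<Rightarrow> bool" where
  "decidable X P \<longleftrightarrow> computable X (\<lambda>i n. of_bool (P i n))"

lemma computableI: "(\<And>i n. run (X i) p n = Some (F i n)) \<Longrightarrow> computable X F"
  unfolding computable_def by blast

text \<open>Each rule collected here takes arbitrary computable functions as arguments of the operation that it
treats, so that repeated introduction reduces the computability of an expression to that of its atoms.
Operators that bind a variable have a premise about pairs, in which the components of the
pair \<open>z\<close> stand for the outer and the bound variable.\<close>

named_theorems computable_intros

lemma computable_of_bool [computable_intros]:
  "decidable X P \<Longrightarrow> computable X (\<lambda>i n. of_bool (P i n))"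
  by (simp add: decidable_def)

lemma computable_id [computable_intros]: "computable X (\<lambda>i n. n)"
  by (rule computableI[of _ "Tuple Fst Snd"]) simp

lemma computable_compose:
  assumes "computable X F" "computable X G"
  shows "computable X (\<lambda>i n. F i (G i n))"
proof -
  from assms obtain p q where "\<And>i n. run (X i) p n = Some (F i n)" "\<And>i n. run (X i) q n = Some (G i n)"
    unfolding computable_def by blast
  then show ?thesis by (intro computableI[of _ "Compose p q"]) simp
qed

lemma computable_prod_encode [computable_intros]:
  assumes "computable X F" "computable X G"
  shows "computable X (\<lambda>i n. prod_encode (F i n, G i n))"
proof -
  from assms obtain p q where "\<And>i n. run (X i) p n = Some (F i n)" "\<And>i n. run (X i) q n = Some (G i n)"
    unfolding computable_def by blast
  then show ?thesis by (intro computableI[of _ "Tuple p q"]) simp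
qed

lemma computable_compose2:
  assumes "computable X (\<lambda>i z. F i (pfst z) (psnd z))" "computable X G" "computable X H"
  shows "computable X (\<lambda>i n. F i (G i n) (H i n))"
  using computable_compose[OF assms(1) computable_prod_encode[OF assms(2,3)]] by simp

lemma computable_pfst [computable_intros]:
  "computable X F \<Longrightarrow> computable X (\<lambda>i n. pfst (F i n))"
  by (rule computable_compose[of X "\<lambda>_. pfst"]) (rule computableI[of _ Fst], simp)

lemma computable_psnd [computable_intros]:
  "computable X F \<Longrightarrow> computable X (\<lambda>i n. psnd (F i n))"
  by (rule computable_compose[of X "\<lambda>_. psnd"]) (rule computableI[of _ Snd], simp)

lemma computable_Suc [computable_intros]:
  "computable X F \<Longrightarrow> computable X (\<lambda>i n. Suc (F i n))"
  by (rule computable_compose[of X "\<lambda>_. Suc"]) (rule computableI[of _ Succ], simp)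

lemma computable_const [computable_intros]: "computable X (\<lambda>i n. c)"
proof (induction c)
  case 0
  show ?case by (rule computableI[of _ Zero]) simp
qed (rule computable_Suc)

lemma decidable_oracle: "computable X F \<Longrightarrow> decidable X (\<lambda>i n. X i (F i n))"
  unfolding decidable_def
  by (rule computable_compose[of X "\<lambda>i n. of_bool (X i n)"]) (rule computableI[of _ Query], simp)

lemma computable_rec_nat [computable_intros]:
  assumes "computable X A" "computable X (\<lambda>i z. H i (pfst z) (pfst (psnd z)) (psnd (psnd z)))"
    "computable X K"
  shows "computable X (\<lambda>i n. rec_nat (A i n) (\<lambda>j r. H i n j r) (K i n))"
proof -
  from assms(1,2) obtain p q where p: "\<And>i n. run (X i) p n = Some (A i n)"
    and q: "\<And>i z. run (X i) q z = Some (H i (pfst z) (pfst (psnd z)) (psnd (psnd z)))"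
    unfolding computable_def by blast
  have "rec_nat (run (X i) p n) (\<lambda>j r. Option.bind r (\<lambda>v. run (X i) q (prod_encode (n, prod_encode (j, v))))) k
     = Some (rec_nat (A i n) (\<lambda>j r. H i n j r) k)" for i n k
    by (induction k) (simp_all add: p q)
  then have "computable X (\<lambda>i z. rec_nat (A i (pfst z)) (\<lambda>j r. H i (pfst z) j r) (psnd z))"
    by (intro computableI[of _ "Prim_Rec p q"]) (simp add: case_prod_unfold)
  from computable_compose2[of X "\<lambda>i n k. rec_nat (A i n) (\<lambda>j r. H i n j r) k", OF this computable_id assms(3)]
  show ?thesis .
qed

lemma computable_Least:
  assumes "decidable X (\<lambda>i z. P i (pfst z) (psnd z))" and ex: "\<And>i n. \<exists>m. P i n m"
  shows "computable X (\<lambda>i n. LEAST m. P i n m)"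
proof -
  have "computable X (\<lambda>i z. rec_nat 1 (\<lambda>j r. 0) (of_bool (P i (pfst z) (psnd z))))"
    using assms(1) by (intro computable_intros)
  then obtain p where p: "\<And>i z. run (X i) p z = Some (rec_nat 1 (\<lambda>j r. 0) (of_bool (P i (pfst z) (psnd z))))"
    unfolding computable_def by blast
  have "run (X i) p (prod_encode (n, m)) = Some 0 \<longleftrightarrow> P i n m" for i n m
    by (simp add: p of_bool_def)
  then show ?thesis using ex
    by (intro computableI[of _ "Minimize p"]) (auto simp: p)
qed

lemma computable_add [computable_intros]:
  assumes "computable X F" "computable X G" shows "computable X (\<lambda>i n. F i n + G i n)"
proof -
  have eq: "a + b = rec_nat a (\<lambda>j r. Suc r) b" for a b by (induction b) auto
  show ?thesis unfolding eq by (intro computable_intros assms)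
qed

lemma computable_mult [computable_intros]:
  assumes "computable X F" "computable X G" shows "computable X (\<lambda>i n. F i n * G i n)"
proof -
  have eq: "a * b = rec_nat 0 (\<lambda>j r. r + a) b" for a b by (induction b) auto
  show ?thesis unfolding eq by (intro computable_intros computable_compose[OF assms(1)] assms)
qed

lemma computable_power [computable_intros]:
  assumes "computable X F" "computable X G" shows "computable X (\<lambda>i n. F i n ^ G i n)"
proof -
  have eq: "a ^ b = rec_nat 1 (\<lambda>j r. a * r) b" for a b by (induction b) auto
  show ?thesis unfolding eq by (intro computable_intros computable_compose[OF assms(1)] assms)
qed

lemma computable_diff [computable_intros]:
  assumes "computable X F" "computable X G" shows "computable X (\<lambda>i n. F i n - G i n)"
proof -
  have "(\<lambda>i n. H i n - 1) = (\<lambda>i n. rec_nat 0 (\<lambda>j r. j) (H i n))" for H :: "'a \<Rightarrow> nat \<Rightarrow> nat"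
    by (intro ext, rename_tac i n, case_tac "H i n") auto
  then have pred: "computable X (\<lambda>i n. H i n - 1)" if "computable X H" for H
    using that by (simp only:) (intro computable_intros)
  have "a - b = rec_nat a (\<lambda>j r. r - 1) b" for a b by (induction b) auto
  then have "(\<lambda>i n. F i n - G i n) = (\<lambda>i n. rec_nat (F i n) (\<lambda>j r. r - 1) (G i n))"
    by (intro ext)
  then show ?thesis by (simp only:) (intro computable_intros pred assms)
qed

lemma computable_sum [computable_intros]:
  assumes "computable X (\<lambda>i z. F i (pfst z) (psnd z))" "computable X B"
  shows "computable X (\<lambda>i n. \<Sum>k<B i n. F i n k)"
proof -
  have eq: "(\<Sum>k<b. f k) = rec_nat 0 (\<lambda>j r. r + f j) b" for b and f :: "nat \<Rightarrow> nat"
    by (induction b) auto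
  show ?thesis unfolding eq
    by (intro computable_intros computable_compose2[OF assms(1)] assms)
qed

lemma decidable_le [computable_intros]:
  assumes "computable X F" "computable X G" shows "decidable X (\<lambda>i n. F i n \<le> G i n)"
proof -
  have eq: "of_bool (a \<le> b) = (1::nat) - (a - b)" for a b :: nat by auto
  show ?thesis unfolding decidable_def eq by (intro computable_intros assms)
qed

lemma decidable_not [computable_intros]:
  assumes "decidable X P" shows "decidable X (\<lambda>i n. \<not> P i n)"
proof -
  have eq: "of_bool (\<not> a) = (1::nat) - of_bool a" for a by auto
  show ?thesis unfolding decidable_def eq by (intro computable_intros assms)
qed

lemma decidable_conj [computable_intros]:
  assumes "decidable X P" "decidable X Q" shows "decidable X (\<lambda>i n. P i n \<and> Q i n)"
proof -
  have eq: "of_bool (a \<and> b) = of_bool a * (of_bool b :: nat)" for a b by auto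
  show ?thesis unfolding decidable_def eq by (intro computable_intros assms)
qed

lemma decidable_disj [computable_intros]:
  assumes "decidable X P" "decidable X Q" shows "decidable X (\<lambda>i n. P i n \<or> Q i n)"
proof -
  have eq: "a \<or> b \<longleftrightarrow> \<not> (\<not> a \<and> \<not> b)" for a b by auto
  show ?thesis unfolding eq by (intro computable_intros assms)
qed

lemma decidable_imp [computable_intros]:
  assumes "decidable X P" "decidable X Q" shows "decidable X (\<lambda>i n. P i n \<longrightarrow> Q i n)"
proof -
  have eq: "(a \<longrightarrow> b) \<longleftrightarrow> \<not> a \<or> b" for a b by auto
  show ?thesis unfolding eq by (intro computable_intros assms)
qed

lemma decidable_if [computable_intros]:
  assumes "decidable X P" "decidable X Q" "decidable X R"
  shows "decidable X (\<lambda>i n. if P i n then Q i n else R i n)"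
  unfolding if_bool_eq_disj by (intro computable_intros assms)

lemma decidable_compose2:
  assumes "decidable X (\<lambda>i z. P i (pfst z) (psnd z))" "computable X F" "computable X G"
  shows "decidable X (\<lambda>i n. P i (F i n) (G i n))"
  using assms computable_compose2[of X "\<lambda>i a b. of_bool (P i a b)"] unfolding decidable_def by blast

lemma decidable_less [computable_intros]:
  assumes "computable X F" "computable X G" shows "decidable X (\<lambda>i n. F i n < G i n)"
  unfolding not_le[symmetric] by (intro computable_intros assms)

lemma decidable_eq [computable_intros]:
  fixes F G :: "'i \<Rightarrow> nat \<Rightarrow> nat"
  assumes "computable X F" "computable X G" shows "decidable X (\<lambda>i n. F i n = G i n)"
  unfolding eq_iff by (intro computable_intros assms)

lemma decidable_bex [computable_intros]:
  assumes "decidable X (\<lambda>i z. P i (pfst z) (psnd z))" "computable X B"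
  shows "decidable X (\<lambda>i n. \<exists>k<B i n. P i n k)"
proof -
  have eq: "(\<exists>k<b. Q k) \<longleftrightarrow> 0 < (\<Sum>k<b. of_bool (Q k) :: nat)" for b :: nat and Q
    by (auto simp: sum_pos2 zero_less_iff_neq_zero simp del: sum_of_bool_eq)
  show ?thesis unfolding eq
    by (intro computable_intros assms)
qed

lemma decidable_ball [computable_intros]:
  assumes "decidable X (\<lambda>i z. P i (pfst z) (psnd z))" "computable X B"
  shows "decidable X (\<lambda>i n. \<forall>k<B i n. P i n k)"
proof -
  have eq: "(\<forall>k<b. Q k) \<longleftrightarrow> \<not> (\<exists>k<b. \<not> Q k)" for b :: nat and Q
    by auto
  show ?thesis unfolding eq
    by (intro computable_intros assms)
qed

lemma computable_if [computable_intros]: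
  assumes "decidable X P" "computable X F" "computable X G"
  shows "computable X (\<lambda>i n. if P i n then F i n else G i n)"
proof -
  have eq: "(if b then x else y) = of_bool b * x + of_bool (\<not> b) * y" for b and x y :: nat by auto
  show ?thesis unfolding eq by (intro computable_intros assms)
qed

lemma computable_div [computable_intros]:
  assumes "computable X F" "computable X G" shows "computable X (\<lambda>i n. F i n div G i n)"
proof -
  \<comment> \<open>The quotient counts the positive multiples of the divisor up to the dividend.\<close>
  have eq: "a div b = (\<Sum>k<a. of_bool (Suc k * b \<le> a \<and> 0 < b))" for a b :: nat
  proof (cases "b = 0")
    case False
    then have "{k \<in> {..<a}. Suc k * b \<le> a \<and> 0 < b} = {..<a div b}"
      apply (auto simp: less_eq_div_iff_mult_less_eq simp flip: Suc_le_eq)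
      by (metis Suc_le_lessD div_le_dividend le_trans less_eq_div_iff_mult_less_eq mult.commute mult_Suc_right Suc_leI)
    then show ?thesis by (simp add: Collect_conj_eq[symmetric] Int_def)
  qed auto
  show ?thesis unfolding eq by (intro computable_intros computable_compose[OF assms(1)] computable_compose[OF assms(2)] assms)
qed

lemma computable_mod [computable_intros]:
  assumes "computable X F" "computable X G" shows "computable X (\<lambda>i n. F i n mod G i n)"
  unfolding minus_div_mult_eq_mod[symmetric] by (intro computable_intros assms)

lemma decidable_bit [computable_intros]:
  assumes "computable X F" "computable X G" shows "decidable X (\<lambda>i n. bit (F i n) (G i n))"
  unfolding bit_iff_odd odd_iff_mod_2_eq_one by (intro computable_intros assms)

section \<open>A normal form for oracle computations\<close>

text \<open>An entry is a claim: the program with code \<open>e\<close> maps \<open>n\<close> to \<open>v\<close>.\<close>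

definition entry :: "nat \<Rightarrow> nat \<Rightarrow> nat \<Rightarrow> nat" where
  "entry e n v = prod_encode (e, prod_encode (n, v))"

text \<open>A claim is justified by a table \<open>F\<close> if one unfolding of the semantics of the outermost
constructor derives it from claims in \<open>F\<close>. The case distinction is made by arithmetic on codes,
which inverts \<open>program_code\<close>, because the check itself has to be computable. Each existential
quantifier stands directly before a claim that mentions its variable; it can then be bounded by the
code of the table.\<close>

definition justified :: "cantor \<Rightarrow> nat set \<Rightarrow> nat \<Rightarrow> nat \<Rightarrow> nat \<Rightarrow> bool" where
  "justified X F e n v \<longleftrightarrow>
     e = 0 \<and> v = 0 \<or> e = 1 \<and> v = Suc n \<or> e = 2 \<and> v = pfst n \<or> e = 3 \<and> v = psnd n \<or>
     e = 4 \<and> v = of_bool (X n) \<or>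
     5 \<le> e \<and> (let d = (e - 5) div 4; p = pfst d; q = psnd d in
       (e - 5) mod 4 = 0 \<and> (\<exists>a. entry p n a \<in> F \<and> (\<exists>b. entry q n b \<in> F \<and> v = prod_encode (a, b))) \<or>
       (e - 5) mod 4 = 1 \<and> (\<exists>a. entry q n a \<in> F \<and> entry p a v \<in> F) \<or>
       (e - 5) mod 4 = 2 \<and>
         (if psnd n = 0 then entry p (pfst n) v \<in> F
          else \<exists>r. entry e (prod_encode (pfst n, psnd n - 1)) r \<in> F \<and>
                   entry q (prod_encode (pfst n, prod_encode (psnd n - 1, r))) v \<in> F) \<or>
       (e - 5) mod 4 = 3 \<and> entry d (prod_encode (n, v)) 0 \<in> F \<and>
         (\<forall>k<v. \<exists>r. entry d (prod_encode (n, k)) (Suc r) \<in> F))"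

lemma justified_shape:
  assumes "(e::nat) = 5 + k + 4 * d" "k < 4"
  shows "justified X F e n v \<longleftrightarrow>
     (k = 0 \<and> (\<exists>a. entry (pfst d) n a \<in> F \<and> (\<exists>b. entry (psnd d) n b \<in> F \<and> v = prod_encode (a, b))) \<or>
      k = 1 \<and> (\<exists>a. entry (psnd d) n a \<in> F \<and> entry (pfst d) a v \<in> F) \<or>
      k = 2 \<and> (if psnd n = 0 then entry (pfst d) (pfst n) v \<in> F
          else \<exists>r. entry e (prod_encode (pfst n, psnd n - 1)) r \<in> F \<and>
                   entry (psnd d) (prod_encode (pfst n, prod_encode (psnd n - 1, r))) v \<in> F) \<or>
      k = 3 \<and> entry d (prod_encode (n, v)) 0 \<in> F \<and>
         (\<forall>k<v. \<exists>r. entry d (prod_encode (n, k)) (Suc r) \<in> F))"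
proof -
  have "e \<noteq> 0" "e \<noteq> 1" "e \<noteq> 2" "e \<noteq> 3" "e \<noteq> 4" "5 \<le> e" "(e - 5) mod 4 = k" "(e - 5) div 4 = d"
    using assms by auto
  then show ?thesis
    unfolding justified_def Let_def by simp
qed

lemma justified_code:
  "justified X F (program_code Zero) n v \<longleftrightarrow> v = 0"
  "justified X F (program_code Succ) n v \<longleftrightarrow> v = Suc n"
  "justified X F (program_code Fst) n v \<longleftrightarrow> v = pfst n"
  "justified X F (program_code Snd) n v \<longleftrightarrow> v = psnd n"
  "justified X F (program_code Query) n v \<longleftrightarrow> v = of_bool (X n)"
  "justified X F (program_code (Tuple p q)) n v \<longleftrightarrow>
     (\<exists>a b. entry (program_code p) n a \<in> F \<and> entry (program_code q) n b \<in> F \<and> v = prod_encode (a, b))"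
  "justified X F (program_code (Compose p q)) n v \<longleftrightarrow>
     (\<exists>a. entry (program_code q) n a \<in> F \<and> entry (program_code p) a v \<in> F)"
  "justified X F (program_code (Prim_Rec p q)) n v \<longleftrightarrow>
     (if psnd n = 0 then entry (program_code p) (pfst n) v \<in> F
      else \<exists>r. entry (program_code (Prim_Rec p q)) (prod_encode (pfst n, psnd n - 1)) r \<in> F \<and>
               entry (program_code q) (prod_encode (pfst n, prod_encode (psnd n - 1, r))) v \<in> F)"
  "justified X F (program_code (Minimize p)) n v \<longleftrightarrow>
     entry (program_code p) (prod_encode (n, v)) 0 \<in> F \<and>
     (\<forall>k<v. \<exists>r. entry (program_code p) (prod_encode (n, k)) (Suc r) \<in> F)"
  subgoal by (simp add: justified_def Let_def)
  subgoal by (simp add: justified_def Let_def)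
  subgoal by (simp add: justified_def Let_def)
  subgoal by (simp add: justified_def Let_def)
  subgoal by (simp add: justified_def Let_def)
  subgoal
    using justified_shape[of "program_code (Tuple p q)" 0 "prod_encode (program_code p, program_code q)" X F n v]
    by (simp del: program_code.simps) (simp add: program_code.simps)
  subgoal
    using justified_shape[of "program_code (Compose p q)" 1 "prod_encode (program_code p, program_code q)" X F n v]
    by (simp del: program_code.simps) (simp add: program_code.simps)
  subgoal
    using justified_shape[of "program_code (Prim_Rec p q)" 2 "prod_encode (program_code p, program_code q)" X F n v]
    by (simp del: program_code.simps) (simp add: program_code.simps)
  subgoal
    using justified_shape[of "program_code (Minimize p)" 3 "program_code p" X F n v]
    by (simp del: program_code.simps) (simp add: program_code.simps)
  done

text \<open>Tables are sets of arbitrary numbers, so every number must be readable as a program.\<close>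

lemma program_code_surj: "\<exists>p. program_code p = e"
proof (induction e rule: less_induct)
  case (less e)
  show ?case
  proof (cases "e < 5")
    case True
    then have "e = 0 \<or> e = 1 \<or> e = 2 \<or> e = 3 \<or> e = 4" by auto
    then show ?thesis using program_code.simps(1-5) by metis
  next
    case False
    define d where "d = (e - 5) div 4"
    have e: "e = 5 + 4 * d \<or> e = 6 + 4 * d \<or> e = 7 + 4 * d \<or> e = 8 + 4 * d"
      using False unfolding d_def by presburger
    have "pfst d \<le> d" "psnd d \<le> d"
      by (metis le_prod_encode_1 le_prod_encode_2 prod.collapse prod_decode_inverse)+
    then have "pfst d < e" "psnd d < e" "d < e" using e by auto
    then obtain p q r where "program_code p = pfst d" "program_code q = psnd d" "program_code r = d"
      using less by metis
    then have "program_code (Tuple p q) = 5 + 4 * d" "program_code (Compose p q) = 6 + 4 * d"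
       "program_code (Prim_Rec p q) = 7 + 4 * d" "program_code (Minimize r) = 8 + 4 * d"
      by simp_all
    then show ?thesis using e by metis
  qed
qed

lemma justified_mono: "justified X F e n v \<Longrightarrow> F \<subseteq> G \<Longrightarrow> justified X G e n v"
proof -
  assume a: "justified X F e n v" and "F \<subseteq> G"
  then have s: "\<And>i. i \<in> F \<Longrightarrow> i \<in> G" by blast
  obtain p where "e = program_code p" using program_code_surj by metis
  then show ?thesis using a
    by (cases p; simp only: justified_code split: if_splits) (blast dest: s)+
qed

definition derivation :: "cantor \<Rightarrow> nat set \<Rightarrow> bool" where
  "derivation X F \<longleftrightarrow> (\<forall>e n v. entry e n v \<in> F \<longrightarrow> justified X F e n v)"

lemma derivation_UN: "(\<And>i. i \<in> I \<Longrightarrow> derivation X (F i)) \<Longrightarrow> derivation X (\<Union>i\<in>I. F i)"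
  unfolding derivation_def by (blast intro: justified_mono)

lemma derivation_Un: "derivation X F \<Longrightarrow> derivation X G \<Longrightarrow> derivation X (F \<union> G)"
  unfolding derivation_def by (blast intro: justified_mono)

lemma entry_inject: "entry e n v = entry e' n' v' \<longleftrightarrow> e = e' \<and> n = n' \<and> v = v'"
  by (simp add: entry_def)

lemma derivation_insert:
  "derivation X F \<Longrightarrow> justified X F e n v \<Longrightarrow> derivation X (insert (entry e n v) F)"
  unfolding derivation_def by (auto simp: entry_inject intro: justified_mono)

text \<open>The definition of derivations does not forbid circular arguments, but none can arise: a claim refers
to claims about proper subprograms and, for primitive recursion, to claims about the same program with
a smaller counter. Induction on the program, and on the counter inside it, therefore applies.\<close>

lemma derivation_sound:
  assumes "derivation X F"
  shows "entry (program_code p) n v \<in> F \<Longrightarrow> run X p n = Some v"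
proof (induction p arbitrary: n v)
  have step: "justified X F e n v" if "entry e n v \<in> F" for e n v
    using that assms unfolding derivation_def by blast
  {
  case (Prim_Rec p q)
  have "run X (Prim_Rec p q) (prod_encode (a, k)) = Some v"
    if "entry (program_code (Prim_Rec p q)) (prod_encode (a, k)) v \<in> F" for a k v
    using that
  proof (induction k arbitrary: v)
    case 0
    from step[OF this] Prim_Rec.IH(1) show ?case unfolding justified_code by simp
  next
    case (Suc k)
    from step[OF Suc.prems] obtain r where
      "entry (program_code (Prim_Rec p q)) (prod_encode (a, k)) r \<in> F"
      "entry (program_code q) (prod_encode (a, prod_encode (k, r))) v \<in> F"
      unfolding justified_code by auto
    from Suc.IH[OF this(1)] Prim_Rec.IH(2)[OF this(2)] show ?case by simp
  qed
  from this[of "pfst n" "psnd n" v] Prim_Rec.prems show ?case by simp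
next
  case (Minimize p)
  have "justified X F (program_code (Minimize p)) n v"
    using Minimize.prems by (rule step)
  then have facts: "entry (program_code p) (prod_encode (n, v)) 0 \<in> F"
    "\<And>k. k < v \<Longrightarrow> \<exists>r. entry (program_code p) (prod_encode (n, k)) (Suc r) \<in> F"
    unfolding justified_code by blast+
  have v: "run X p (prod_encode (n, v)) = Some 0"
    using facts(1) by (rule Minimize.IH)
  have less: "\<exists>r. run X p (prod_encode (n, k)) = Some (Suc r)" if "k < v" for k
    using facts(2)[OF that] Minimize.IH by blast
  have "(LEAST m. run X p (prod_encode (n, m)) = Some 0) = v"
  proof (rule Least_equality)
    show "run X p (prod_encode (n, v)) = Some 0" by (rule v)
  next
    fix m assume "run X p (prod_encode (n, m)) = Some 0"
    then show "v \<le> m" using less[of m] by (cases "v \<le> m") auto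
  qed
  moreover have "\<exists>m. run X p (prod_encode (n, m)) = Some 0 \<and>
           (\<forall>k<m. run X p (prod_encode (n, k)) \<noteq> None)"
    using v less by (intro exI[of _ v]) force
  ultimately show ?case by simp
next
  case Zero
  from step[OF this] show ?case unfolding justified_code by simp
next
  case Succ
  from step[OF this] show ?case unfolding justified_code by simp
next
  case Fst
  from step[OF this] show ?case unfolding justified_code by simp
next
  case Snd
  from step[OF this] show ?case unfolding justified_code by simp
next
  case Query
  from step[OF this] show ?case unfolding justified_code by simp
next
  case (Tuple p q)
  from step[OF Tuple.prems] obtain a b where
    "entry (program_code p) n a \<in> F" "entry (program_code q) n b \<in> F" "v = prod_encode (a, b)"
    unfolding justified_code by blast
  then show ?case using Tuple.IH by simp
next
  case (Compose p q)
  from step[OF Compose.prems] obtain a where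
    "entry (program_code q) n a \<in> F" "entry (program_code p) a v \<in> F"
    unfolding justified_code by blast
  then show ?case using Compose.IH by simp
  }
qed

text \<open>Justification is monotone in the table, so the finitely many derivations of the subcomputations can
be united and extended by the new claim. For a minimization, one derivation is needed for each
value up to the one found.\<close>

lemma derivation_complete:
  "run X p n = Some v \<Longrightarrow> \<exists>F. finite F \<and> derivation X F \<and> entry (program_code p) n v \<in> F"
proof (induction p arbitrary: n v)
  have extend: "\<exists>G. finite G \<and> derivation X G \<and> entry e n v \<in> G"
    if "finite F" "derivation X F" "justified X F e n v" for F e n v
    using that derivation_insert by (intro exI[of _ "insert (entry e n v) F"]) auto
  have axiom: "\<exists>G. finite G \<and> derivation X G \<and> entry e n v \<in> G"
    if "justified X {} e n v" for e n v
    using that by (intro extend[of "{}"]) (auto simp: derivation_def)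
  {
    case Zero
    then show ?case by (intro axiom) (auto simp: justified_code simp del: program_code.simps)
  next
    case Succ
    then show ?case by (intro axiom) (auto simp: justified_code simp del: program_code.simps)
  next
    case Fst
    then show ?case by (intro axiom) (auto simp: justified_code simp del: program_code.simps)
  next
    case Snd
    then show ?case by (intro axiom) (auto simp: justified_code simp del: program_code.simps)
  next
    case Query
    then show ?case by (intro axiom) (auto simp: justified_code simp del: program_code.simps)
  next
    case (Tuple p q)
    then obtain a b where ab: "run X p n = Some a" "run X q n = Some b" "v = prod_encode (a, b)"
      by (auto simp: bind_eq_Some_conv)
    with Tuple.IH obtain F G where
      "finite F" "derivation X F" "entry (program_code p) n a \<in> F"
      "finite G" "derivation X G" "entry (program_code q) n b \<in> G"
      by meson
    then show ?case using ab
      by (intro extend[of "F \<union> G"])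
        (auto simp: justified_code simp del: program_code.simps intro: derivation_Un)
  next
    case (Compose p q)
    then obtain a where ab: "run X q n = Some a" "run X p a = Some v"
      by (auto simp: bind_eq_Some_conv)
    with Compose.IH obtain F G where
      "finite F" "derivation X F" "entry (program_code p) a v \<in> F"
      "finite G" "derivation X G" "entry (program_code q) n a \<in> G"
      by meson
    then show ?case using ab
      by (intro extend[of "F \<union> G"])
        (auto simp: justified_code simp del: program_code.simps intro: derivation_Un)
  next
    case (Prim_Rec p q)
    have "\<exists>F. finite F \<and> derivation X F \<and> entry (program_code (Prim_Rec p q)) (prod_encode (a, k)) v \<in> F"
      if "run X (Prim_Rec p q) (prod_encode (a, k)) = Some v" for a k v
      using that
    proof (induction k arbitrary: v)
      case 0
      then have "run X p a = Some v" by simp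
      with Prim_Rec.IH obtain F where "finite F" "derivation X F" "entry (program_code p) a v \<in> F"
        by meson
      then show ?case
        by (intro extend[of F]) (auto simp: justified_code simp del: program_code.simps)
    next
      case (Suc k)
      then obtain r where r: "run X (Prim_Rec p q) (prod_encode (a, k)) = Some r"
        "run X q (prod_encode (a, prod_encode (k, r))) = Some v"
        by (auto simp: bind_eq_Some_conv)
      with Suc.IH Prim_Rec.IH(2) obtain F G where
        "finite F" "derivation X F" "entry (program_code (Prim_Rec p q)) (prod_encode (a, k)) r \<in> F"
        "finite G" "derivation X G" "entry (program_code q) (prod_encode (a, prod_encode (k, r))) v \<in> G"
        by meson
      then show ?case
        by (intro extend[of "F \<union> G"])
          (auto simp: justified_code simp del: program_code.simps intro: derivation_Un)
    qed
    from this[of "pfst n" "psnd n" v] Prim_Rec.prems show ?case by simp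
  next
    case (Minimize p)
    define f where "f m = run X p (prod_encode (n, m))" for m
    from Minimize.prems obtain m where m: "f m = Some 0" "\<forall>k<m. f k \<noteq> None"
      and v: "v = (LEAST m. f m = Some 0)"
      by (auto simp: f_def split: if_splits)
    have "f v = Some 0" unfolding v using m(1) by (rule LeastI)
    have "v \<le> m" unfolding v using m(1) by (rule Least_le)
    have less: "\<exists>r. f k = Some (Suc r)" if "k < v" for k
    proof -
      have "f k \<noteq> None" using m(2) that \<open>v \<le> m\<close> by auto
      moreover have "f k \<noteq> Some 0" using not_less_Least that unfolding v by blast
      ultimately show ?thesis by (metis not0_implies_Suc option.exhaust)
    qed
    have "\<exists>F. finite F \<and> derivation X F \<and>
      (\<exists>r. f k = Some r \<and> entry (program_code p) (prod_encode (n, k)) r \<in> F)" if "k \<le> v" for k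
    proof -
      obtain r where "f k = Some r"
        using less[of k] \<open>f v = Some 0\<close> \<open>k \<le> v\<close> by (cases "k = v") auto
      with Minimize.IH[of "prod_encode (n, k)" r] show ?thesis unfolding f_def by blast
    qed
    then obtain F where F: "\<And>k. k \<le> v \<Longrightarrow> finite (F k) \<and> derivation X (F k) \<and>
      (\<exists>r. f k = Some r \<and> entry (program_code p) (prod_encode (n, k)) r \<in> F k)"
      by metis
    show ?case
    proof (rule extend[of "\<Union>k\<in>{..v}. F k"])
      show "finite (\<Union>k\<in>{..v}. F k)" "derivation X (\<Union>k\<in>{..v}. F k)"
        using F by (auto intro: derivation_UN)
      have "entry (program_code p) (prod_encode (n, v)) 0 \<in> F v"
        using F[of v] \<open>f v = Some 0\<close> by auto
      moreover have "\<exists>r. entry (program_code p) (prod_encode (n, k)) (Suc r) \<in> F k" if "k < v" for k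
        using F[of k] less[OF that] that by auto
      ultimately show "justified X (\<Union>k\<in>{..v}. F k) (program_code (Minimize p)) n v"
        unfolding justified_code by (auto simp: less_imp_le) (meson atMost_iff less_imp_le)
    qed
  }
qed

text \<open>This is Kleene's predicate T: the binary digits of \<open>t\<close> describe a finite table.\<close>

definition derives :: "cantor \<Rightarrow> nat \<Rightarrow> nat \<Rightarrow> nat \<Rightarrow> nat \<Rightarrow> bool" where
  "derives X t e n v \<longleftrightarrow> derivation X (set_decode t) \<and> entry e n v \<in> set_decode t"

lemma run_iff_derives: "run X p n = Some v \<longleftrightarrow> (\<exists>t. derives X t (program_code p) n v)"
proof
  assume "run X p n = Some v"
  then obtain F where "finite F" "derivation X F" "entry (program_code p) n v \<in> F"
    using derivation_complete by blast
  then have "derives X (set_encode F) (program_code p) n v"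
    by (simp add: derives_def)
  then show "\<exists>t. derives X t (program_code p) n v" ..
qed (auto simp: derives_def intro: derivation_sound)

lemma set_decode_less: "i \<in> set_decode t \<Longrightarrow> i < t"
proof -
  assume "i \<in> set_decode t"
  then have "t div 2 ^ i \<noteq> 0" by (intro notI) (simp add: set_decode_def)
  then have "2 ^ i \<le> t" by (simp add: div_eq_0_iff)
  then show "i < t" using less_exp[of i] by linarith
qed

lemma entry_less:
  assumes "entry e n v \<in> set_decode t"
  shows "e < t" "n < t" "v < t"
proof -
  have "e \<le> entry e n v" "n \<le> entry e n v" "v \<le> entry e n v"
    unfolding entry_def using le_prod_encode_1 le_prod_encode_2 le_trans by blast+
  then show "e < t" "n < t" "v < t"
    using set_decode_less[OF assms] by linarith+
qed

text \<open>A query of position \<open>n\<close> occurs in the table as a claim with argument \<open>n\<close>, and the code of a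
table exceeds all numbers in its claims. So \<open>t\<close> bounds both the length of the computation and its
use of the oracle.\<close>

lemma derives_cong:
  assumes "\<And>j. j < t \<Longrightarrow> X j = Y j"
  shows "derives X t e n v \<longleftrightarrow> derives Y t e n v"
proof -
  have "justified X (set_decode t) e n v \<longleftrightarrow> justified Y (set_decode t) e n v"
    if "entry e n v \<in> set_decode t" for e n v
    unfolding justified_def using assms[OF entry_less(2)[OF that]] by simp
  then show ?thesis unfolding derives_def derivation_def by blast
qed

text \<open>The oracle \<open>Y i m\<close> of the simulated computation may depend on the input \<open>m\<close>. This makes it
possible to run a program on all strings of a given length, represented by \<open>bit c\<close> for numbers
\<open>c\<close>.\<close>

lemma decidable_derives:
  assumes "decidable X (\<lambda>i z. Y i (pfst z) (psnd z))"
    "computable X T" "computable X E" "computable X N" "computable X V"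
  shows "decidable X (\<lambda>i m. derives (Y i m) (T i m) (E i m) (N i m) (V i m))"
proof -
  have bound: "(\<exists>a. entry (e a) (n a) (v a) \<in> set_decode t \<and> P a) \<longleftrightarrow>
      (\<exists>a<t. entry (e a) (n a) (v a) \<in> set_decode t \<and> P a)"
    if "\<And>a. a \<le> entry (e a) (n a) (v a)" for e n v t and P :: "nat \<Rightarrow> bool"
    using that set_decode_less le_less_trans by meson
  have le_entry: "a \<le> entry a n v" "a \<le> entry e a v" "a \<le> entry e n a" "a \<le> entry e n (Suc a)" for a e n v
    unfolding entry_def
    by (metis le_prod_encode_1 le_prod_encode_2 le_trans le_SucI order_refl Suc_leD)+
  have bound': "(\<exists>a. entry e n (Suc a) \<in> set_decode t) \<longleftrightarrow> (\<exists>a<t. entry e n (Suc a) \<in> set_decode t)" for e n t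
    using bound[of "\<lambda>_. e" "\<lambda>_. n" Suc t "\<lambda>_. True"] le_entry by simp
  have bounded: "derives Z t e n v \<longleftrightarrow> entry e n v \<in> set_decode t \<and>
    (\<forall>e<t. \<forall>n<t. \<forall>v<t. entry e n v \<in> set_decode t \<longrightarrow> justified Z (set_decode t) e n v)" for Z t e n v
    unfolding derives_def derivation_def using entry_less by metis
  show ?thesis
    unfolding bounded justified_def Let_def bound[OF le_entry(1)] bound[OF le_entry(2)]
      bound[OF le_entry(3)] bound'
    unfolding entry_def set_decode_def mem_Collect_eq odd_iff_mod_2_eq_one
    by (intro computable_intros assms decidable_compose2[OF assms(1)]
      computable_compose[OF assms(2)])
qed

section \<open>The uniform measure on Cantor space\<close>

interpretation uniform: prob_space uniform
  unfolding uniform_def by (intro prob_space_PiM) (rule measure_pmf.prob_space_axioms)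

interpretation coins: product_prob_space "\<lambda>_. measure_pmf (bernoulli_pmf (1/2))" "UNIV :: nat set"
  rewrites "PiM UNIV (\<lambda>_. measure_pmf (bernoulli_pmf (1/2))) = uniform"
  by unfold_locales (simp_all add: uniform_def)

lemma space_uniform [simp]: "space uniform = UNIV"
  by (simp add: uniform_def space_PiM)

lemma
  assumes "finite J"
  shows cylinder_sets: "{x. \<forall>j\<in>J. x j = a j} \<in> sets uniform"
    and cylinder_prob: "measure uniform {x. \<forall>j\<in>J. x j = a j} = 1 / 2 ^ card J"
proof -
  have eq: "{x. \<forall>j\<in>J. x j = a j} = {x \<in> space uniform. \<forall>j\<in>J. x j \<in> {a j}}"
    by auto
  have "(\<lambda>x. x j) \<in> measurable uniform (measure_pmf (bernoulli_pmf (1/2)))" for j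
    unfolding uniform_def by (intro measurable_component_singleton) simp
  then have [measurable]: "(\<lambda>x. x j) \<in> measurable uniform (count_space UNIV)" for j
    by simp
  have "{x \<in> space uniform. \<forall>j\<in>J. x j \<in> {a j}} \<in> sets uniform"
    using assms by measurable
  then show "{x. \<forall>j\<in>J. x j = a j} \<in> sets uniform" unfolding eq .
  have p: "measure (measure_pmf (bernoulli_pmf (1/2))) {b} = 1/2" for b
    by (simp add: measure_pmf_single)
  have "measure uniform {x \<in> space uniform. \<forall>j\<in>J. x j \<in> {a j}} = (\<Prod>j\<in>J. measure (measure_pmf (bernoulli_pmf (1/2))) {a j})"
    using coins.emeasure_PiM_Collect[of J "\<lambda>j. {a j}"] assms
    by (simp add: uniform.emeasure_eq_measure measure_pmf.emeasure_eq_measure prod_ennreal prod_nonneg)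
  then show "measure uniform {x. \<forall>j\<in>J. x j = a j} = 1 / 2 ^ card J"
    unfolding eq p by (simp add: power_one_over)
qed

text \<open>With values in \<open>bool\<close> these are the clopen sets, together with a bound on the
number of bits that decide membership.\<close>

definition depends_below :: "nat \<Rightarrow> (cantor \<Rightarrow> 'a) \<Rightarrow> bool" where
  "depends_below m \<phi> \<longleftrightarrow> (\<forall>x y. (\<forall>j<m. x j = y j) \<longrightarrow> \<phi> x = \<phi> y)"

lemma depends_belowD: "depends_below m \<phi> \<Longrightarrow> (\<And>j. j < m \<Longrightarrow> x j = y j) \<Longrightarrow> \<phi> x = \<phi> y"
  unfolding depends_below_def by blast

text \<open>Strings of length \<open>m\<close> are the numbers \<open>c < 2 ^ m\<close>, read as the real \<open>bit c\<close>.\<close>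

lemma string_prefix: "\<exists>c<2 ^ m. \<forall>j<m. bit (c::nat) j = x j"
  by (intro exI[of _ "take_bit m (horner_sum of_bool 2 (map x [0..<m]))"])
    (simp add: bit_take_bit_iff bit_horner_sum_bit_iff)

lemma string_eqI:
  assumes "(c::nat) < 2 ^ m" "d < 2 ^ m" "\<And>j. j < m \<Longrightarrow> bit c j = bit d j"
  shows "c = d"
proof -
  have "take_bit m c = take_bit m d"
    using assms(3) by (auto simp: bit_eq_iff bit_take_bit_iff)
  then show ?thesis using assms(1,2) by (simp add: take_bit_nat_eq_self)
qed

text \<open>The event is the disjoint union, over the strings \<open>c\<close> of length \<open>m\<close> that satisfy
\<open>\<phi>\<close>, of cylinders that fix the bits below \<open>m\<close> and those in \<open>J\<close>. The cases
\<open>J = {}\<close> and \<open>J = {k}\<close> are the ones of interest.\<close>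

lemma
  assumes "depends_below m \<phi>" "depends_below m h" "finite J" "J \<inter> {..<m} = {}"
  shows sets_depends_below_aux: "{x. \<phi> x \<and> (\<forall>j\<in>J. x j = h x)} \<in> sets uniform"
    and prob_depends_below_aux: "measure uniform {x. \<phi> x \<and> (\<forall>j\<in>J. x j = h x)} =
      card {c::nat. c < 2 ^ m \<and> \<phi> (bit c)} / 2 ^ (m + card J)"
proof -
  define C where "C = {c::nat. c < 2 ^ m \<and> \<phi> (bit c)}"
  define K where "K c = {x. \<forall>j\<in>{..<m} \<union> J. x j = (if j < m then bit c j else h (bit c))}" for c :: nat
  have [simp]: "finite C" unfolding C_def by simp
  have K: "K c = {x. (\<forall>j<m. x j = bit c j) \<and> (\<forall>j\<in>J. x j = h x)}" for c
  proof -
    have "j \<in> J \<Longrightarrow> \<not> j < m" for j using assms(4) by blast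
    then have "K c = {x. (\<forall>j<m. x j = bit c j) \<and> (\<forall>j\<in>J. x j = h (bit c))}"
      unfolding K_def by auto
    also have "h (bit c) = h x" if "\<forall>j<m. x j = bit c j" for x
      using depends_belowD[OF assms(2), of x "bit c"] that by simp
    then have "{x. (\<forall>j<m. x j = bit c j) \<and> (\<forall>j\<in>J. x j = h (bit c))} =
        {x. (\<forall>j<m. x j = bit c j) \<and> (\<forall>j\<in>J. x j = h x)}"
      by auto
    finally show ?thesis .
  qed
  have [simp]: "K c \<in> sets uniform" for c
    unfolding K_def using assms(3) by (intro cylinder_sets) simp
  have prob_K: "measure uniform (K c) = 1 / 2 ^ (m + card J)" for c
    using assms(3,4) unfolding K_def
    by (subst cylinder_prob) (simp_all add: card_Un_disjoint Int_commute)
  have UN: "{x. \<phi> x \<and> (\<forall>j\<in>J. x j = h x)} = (\<Union>c\<in>C. K c)"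
  proof (intro set_eqI iffI)
    fix x assume x: "x \<in> {x. \<phi> x \<and> (\<forall>j\<in>J. x j = h x)}"
    obtain c :: nat where c: "c < 2 ^ m" "\<forall>j<m. bit c j = x j" using string_prefix by blast
    then have "\<phi> (bit c) = \<phi> x" using depends_belowD[OF assms(1)] by blast
    then show "x \<in> (\<Union>c\<in>C. K c)" using x c unfolding K C_def by auto
  next
    fix x assume "x \<in> (\<Union>c\<in>C. K c)"
    then obtain c :: nat where c: "\<phi> (bit c)" "\<forall>j<m. x j = bit c j" "\<forall>j\<in>J. x j = h x"
      unfolding K C_def by blast
    then have "\<phi> (bit c) = \<phi> x" using depends_belowD[OF assms(1)] by metis
    then show "x \<in> {x. \<phi> x \<and> (\<forall>j\<in>J. x j = h x)}" using c by blast
  qed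
  show "{x. \<phi> x \<and> (\<forall>j\<in>J. x j = h x)} \<in> sets uniform"
    unfolding UN by (intro sets.finite_UN) simp_all
  have "disjoint_family_on K C"
    unfolding disjoint_family_on_def
  proof (intro ballI impI equals0I)
    fix c d x assume *: "c \<in> C" "d \<in> C" "c \<noteq> d" "x \<in> K c \<inter> K d"
    then have "bit c j = bit d j" if "j < m" for j using that unfolding K by auto
    then show False using * string_eqI[of c m d] unfolding C_def by auto
  qed
  then have "measure uniform (\<Union>c\<in>C. K c) = (\<Sum>c\<in>C. measure uniform (K c))"
    by (intro uniform.finite_measure_finite_Union) auto
  then show "measure uniform {x. \<phi> x \<and> (\<forall>j\<in>J. x j = h x)} =
      card {c::nat. c < 2 ^ m \<and> \<phi> (bit c)} / 2 ^ (m + card J)"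
    unfolding UN by (simp add: prob_K C_def)
qed

lemma sets_depends_below: "depends_below m \<phi> \<Longrightarrow> {x. \<phi> x} \<in> sets uniform"
  using sets_depends_below_aux[of m \<phi> "\<lambda>_. True" "{}"] by (simp add: depends_below_def)

lemma prob_depends_below:
  "depends_below m \<phi> \<Longrightarrow> measure uniform {x. \<phi> x} = card {c::nat. c < 2 ^ m \<and> \<phi> (bit c)} / 2 ^ m"
  using prob_depends_below_aux[of m \<phi> "\<lambda>_. True" "{}"] by (simp add: depends_below_def)

text \<open>A bit that has not been read is predicted correctly with probability one half, independently of
everything that has been read.\<close>

lemma prob_predict_later_bit:
  assumes "depends_below m \<phi>" "depends_below m h" "m \<le> k"
  shows "{x. \<phi> x \<and> x k = h x} \<in> sets uniform"
    and "measure uniform {x. \<phi> x \<and> x k = h x} = measure uniform {x. \<phi> x} / 2"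
  using sets_depends_below_aux[OF assms(1,2), of "{k}"] prob_depends_below_aux[OF assms(1,2), of "{k}"]
    assms(3) by (simp_all add: prob_depends_below[OF assms(1)])

text \<open>The sets with this property contain the subbasic cylinders and are closed under complement and
countable union: a union is approximated by a finite part of it, whose members are in turn replaced by
clopen sets. Hence they include the generated sigma-algebra.\<close>

lemma clopen_approximation:
  assumes "S \<in> sets uniform" "0 < e"
  shows "\<exists>m B. depends_below m (\<lambda>x. x \<in> B) \<and> measure uniform (sym_diff S B) < e"
proof -
  have B_sets: "B \<in> sets uniform" if "depends_below m (\<lambda>x. x \<in> B)" for m B
    using sets_depends_below[OF that] by simp
  have sets: "sets uniform = sigma_sets UNIV {{f. f i \<in> A} | i A. True}"
    unfolding uniform_def sets_PiM_single by simp
  have "S \<in> sigma_sets UNIV {{f. f i \<in> A} | i A. True}"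
    using assms(1) sets by simp
  then show ?thesis using assms(2)
  proof (induction arbitrary: e)
    case (Basic S)
    then obtain i A where S: "S = {f. f i \<in> A}" by blast
    have "depends_below (Suc i) (\<lambda>x. x \<in> S)" unfolding S depends_below_def by simp
    then show ?case using Basic.prems by (intro exI[of _ "Suc i"] exI[of _ S]) simp
  next
    case Empty
    then show ?case by (intro exI[of _ 0] exI[of _ "{}"]) (simp add: depends_below_def)
  next
    case (Compl S)
    then obtain m B where B: "depends_below m (\<lambda>x. x \<in> B)" "measure uniform (sym_diff S B) < e"
      by blast
    have "sym_diff (UNIV - S) (- B) = sym_diff S B" by blast
    then show ?case using B by (intro exI[of _ m] exI[of _ "- B"]) (simp add: depends_below_def)
  next
    case (Union A)
    have A [measurable]: "A i \<in> sets uniform" for i using Union.hyps sets by simp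
    have "(\<lambda>n. measure uniform (\<Union>i<n. A i)) \<longlonglongrightarrow> measure uniform (\<Union>n. \<Union>i<n. A i)"
      by (intro uniform.finite_Lim_measure_incseq incseq_SucI UN_mono) auto
    moreover have "(\<Union>n. \<Union>i<n. A i) = (\<Union>i. A i)" by blast
    ultimately have "\<forall>\<^sub>F n in sequentially. measure uniform (\<Union>i. A i) - e / 2 < measure uniform (\<Union>i<n. A i)"
      using Union.prems by (intro order_tendstoD(1)) auto
    then obtain N where N: "measure uniform (\<Union>i. A i) - e / 2 < measure uniform (\<Union>i<N. A i)"
      by (auto simp: eventually_sequentially)
    have "\<exists>m B. depends_below m (\<lambda>x. x \<in> B) \<and> measure uniform (sym_diff (A i) B) < e / (2 * Suc N)" for i
      using Union.prems by (intro Union.IH) simp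
    then obtain m B where B: "\<And>i. depends_below (m i) (\<lambda>x. x \<in> B i)"
      and AB: "\<And>i. measure uniform (sym_diff (A i) (B i)) < e / (2 * Suc N)" by metis
    have [measurable]: "B i \<in> sets uniform" for i using B B_sets by blast
    have "depends_below (\<Sum>i<N. m i) (\<lambda>x. x \<in> (\<Union>i<N. B i))"
      unfolding depends_below_def
    proof (intro allI impI)
      fix x y :: cantor assume xy: "\<forall>j<\<Sum>i<N. m i. x j = y j"
      have "x \<in> B i \<longleftrightarrow> y \<in> B i" if "i < N" for i
      proof -
        have "m i \<le> (\<Sum>i<N. m i)" using that by (intro member_le_sum) auto
        then show ?thesis using xy by (intro depends_belowD[OF B[of i]]) auto
      qed
      then show "(x \<in> (\<Union>i<N. B i)) = (y \<in> (\<Union>i<N. B i))" by auto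
    qed
    moreover have "measure uniform (sym_diff (\<Union>i. A i) (\<Union>i<N. B i)) < e"
    proof -
      have "measure uniform (sym_diff (\<Union>i. A i) (\<Union>i<N. B i))
        \<le> measure uniform (((\<Union>i. A i) - (\<Union>i<N. A i)) \<union> (\<Union>i<N. sym_diff (A i) (B i)))"
        by (intro uniform.finite_measure_mono) auto
      also have "\<dots> \<le> measure uniform ((\<Union>i. A i) - (\<Union>i<N. A i)) + measure uniform (\<Union>i<N. sym_diff (A i) (B i))"
        by (intro measure_Un_le) auto
      also have "measure uniform ((\<Union>i. A i) - (\<Union>i<N. A i)) < e / 2"
        using N by (subst uniform.finite_measure_Diff) auto
      also have "measure uniform (\<Union>i<N. sym_diff (A i) (B i)) \<le> (\<Sum>i<N. measure uniform (sym_diff (A i) (B i)))"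
        by (intro uniform.finite_measure_subadditive_finite) auto
      also have "\<dots> \<le> (\<Sum>i<N. e / (2 * Suc N))"
        using AB by (intro sum_mono) (simp add: less_imp_le)
      also have "\<dots> \<le> e / 2" using Union.prems by (simp add: field_simps)
      finally show ?thesis by simp
    qed
    ultimately show ?case by blast
  qed
qed

text \<open>A form of Lebesgue's density theorem. If \<open>S\<close> had density at most \<open>d\<close> in every cylinder, then
summing over the cylinders of a clopen approximation \<open>B\<close> would bound the measure of
\<open>S \<inter> B\<close> by \<open>d\<close> times that of \<open>B\<close>, which is impossible once \<open>B\<close> is close to
\<open>S\<close>.\<close>

lemma dense_cylinder:
  assumes S: "S \<in> sets uniform" "0 < measure uniform S" and d: "0 \<le> d" "d < 1"
  shows "\<exists>m b. b < 2 ^ m \<and> d / 2 ^ m < measure uniform {x \<in> S. \<forall>j<m. x j = bit (b::nat) j}"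
proof (rule ccontr)
  assume "\<not> ?thesis"
  then have sparse: "measure uniform {x \<in> S. \<forall>j<m. x j = bit b j} \<le> d / 2 ^ m" if "b < 2 ^ m" for m and b :: nat
    using that not_less by blast
  \<comment> \<open>Below this error the estimates at the end of the proof contradict each other.\<close>
  define e where "e = (1 - d) * measure uniform S / 2"
  have "0 < e" unfolding e_def using assms by simp
  then obtain m B where B: "depends_below m (\<lambda>x. x \<in> B)" "measure uniform (sym_diff S B) < e"
    using clopen_approximation S(1) by blast
  have [measurable]: "B \<in> sets uniform" using sets_depends_below[OF B(1)] by simp
  note [measurable] = S(1)
  define C where "C = {c::nat. c < 2 ^ m \<and> bit c \<in> B}"
  have prob_B: "measure uniform B = card C / 2 ^ m"
    using prob_depends_below[OF B(1)] by (simp add: C_def)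
  have sub: "S \<inter> B \<subseteq> (\<Union>c\<in>C. {x \<in> S. \<forall>j<m. x j = bit c j})"
  proof
    fix x assume x: "x \<in> S \<inter> B"
    obtain c :: nat where c: "c < 2 ^ m" "\<forall>j<m. bit c j = x j" using string_prefix by blast
    then have "bit c \<in> B \<longleftrightarrow> x \<in> B" using depends_belowD[OF B(1)] by blast
    then have "c \<in> C" using x c(1) by (simp add: C_def)
    moreover have "x \<in> {x \<in> S. \<forall>j<m. x j = bit c j}" using x c(2) by simp
    ultimately show "x \<in> (\<Union>c\<in>C. {x \<in> S. \<forall>j<m. x j = bit c j})" by blast
  qed
  have cyl [measurable]: "{x \<in> S. \<forall>j<m. x j = bit c j} \<in> sets uniform" for c :: nat
  proof -
    have "{x \<in> S. \<forall>j<m. x j = bit c j} = S \<inter> {x. \<forall>j\<in>{..<m}. x j = bit c j}" by blast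
    then show ?thesis by (simp only:) (intro sets.Int S(1) cylinder_sets finite_lessThan)
  qed
  have [simp]: "finite C" unfolding C_def by simp
  have "measure uniform (S \<inter> B) \<le> measure uniform (\<Union>c\<in>C. {x \<in> S. \<forall>j<m. x j = bit c j})"
    by (intro uniform.finite_measure_mono sub sets.finite_UN cyl) simp
  also have "\<dots> \<le> (\<Sum>c\<in>C. measure uniform {x \<in> S. \<forall>j<m. x j = bit c j})"
    by (intro uniform.finite_measure_subadditive_finite image_subsetI cyl) simp
  also have "\<dots> \<le> (\<Sum>c\<in>C. d / 2 ^ m)"
    by (intro sum_mono sparse) (simp add: C_def)
  also have "\<dots> = d * measure uniform B" by (simp add: prob_B)
  also have "measure uniform B \<le> measure uniform ((S \<inter> B) \<union> sym_diff S B)"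
    by (intro uniform.finite_measure_mono) auto
  also have "\<dots> \<le> measure uniform (S \<inter> B) + measure uniform (sym_diff S B)"
    by (intro measure_Un_le) auto
  finally have 1: "measure uniform (S \<inter> B) \<le> d * (measure uniform (S \<inter> B) + measure uniform (sym_diff S B))"
    using d by (simp add: mult_left_mono)
  have "measure uniform S \<le> measure uniform ((S \<inter> B) \<union> sym_diff S B)"
    by (intro uniform.finite_measure_mono) auto
  also have "\<dots> \<le> measure uniform (S \<inter> B) + measure uniform (sym_diff S B)"
    by (intro measure_Un_le) auto
  finally have 2: "measure uniform S \<le> measure uniform (S \<inter> B) + measure uniform (sym_diff S B)" .
  have "(1 - d) * measure uniform S \<le> (1 - d) * (measure uniform (S \<inter> B) + measure uniform (sym_diff S B))"
    using 2 d by (intro mult_left_mono) auto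
  also have "\<dots> \<le> measure uniform (sym_diff S B)"
    using 1 by (simp add: algebra_simps)
  also have "\<dots> < e" by (rule B)
  also have "e \<le> (1 - d) * measure uniform S" unfolding e_def using d by simp
  finally show False by simp
qed

definition even_part :: "cantor \<Rightarrow> cantor" where "even_part v = (\<lambda>n. v (2 * n))"

lemma even_part_join [simp]: "even_part (y \<squnion>\<^sub>T r) = y"
  by (simp add: even_part_def join_def)

lemma distr_even_part: "distr uniform uniform even_part = uniform"
  using distr_PiM_reindex[of UNIV "\<lambda>_. measure_pmf (bernoulli_pmf (1/2))" "\<lambda>n::nat. 2 * n" UNIV]
  by (simp add: uniform_def[symmetric] even_part_def[abs_def] measure_pmf.prob_space_axioms inj_on_def restrict_def)

lemma measurable_even_part: "even_part \<in> measurable uniform uniform"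
  unfolding uniform_def even_part_def
  by (intro measurable_PiM_single') auto

section \<open>Replacing oracles and deciding existential questions\<close>

lemma depends_below_mono: "depends_below m \<phi> \<Longrightarrow> m \<le> n \<Longrightarrow> depends_below n \<phi>"
  unfolding depends_below_def using less_le_trans[of _ m n] by simp

lemma depends_below_derives_join: "depends_below t (\<lambda>x. derives (x \<squnion>\<^sub>T w) t e n v)"
  unfolding depends_below_def
  by (intro allI impI derives_cong) (auto simp: join_def)

lemma decidable_compose: "decidable X P \<Longrightarrow> computable X F \<Longrightarrow> decidable X (\<lambda>i n. P i (F i n))"
  unfolding decidable_def by (rule computable_compose)

lemma decidable_iff [computable_intros]:
  assumes "decidable X P" "decidable X Q" shows "decidable X (\<lambda>i n. P i n \<longleftrightarrow> Q i n)"
  unfolding iff_conv_conj_imp by (intro computable_intros assms)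

lemma decidable_const [computable_intros]: "decidable X (\<lambda>i n. b)"
  unfolding decidable_def by (rule computable_const)

lemma decidable_join [computable_intros]:
  assumes "decidable X (\<lambda>i n. Y i n (F i n div 2))" "decidable X (\<lambda>i n. Z i n (F i n div 2))"
    "computable X F"
  shows "decidable X (\<lambda>i n. (Y i n \<squnion>\<^sub>T Z i n) (F i n))"
  unfolding join_def even_iff_mod_2_eq_zero by (intro computable_intros assms)

lemma decidable_join_left:
  assumes "computable (\<lambda>y. y \<squnion>\<^sub>T w) F" shows "decidable (\<lambda>y. y \<squnion>\<^sub>T w) (\<lambda>y n. y (F y n))"
proof -
  have eq: "y k = (y \<squnion>\<^sub>T w) (2 * k)" for y k by (simp add: join_def)
  show ?thesis unfolding eq[of _ "F _ _"] by (intro decidable_oracle computable_intros assms)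
qed

lemma decidable_join_right:
  assumes "computable (\<lambda>y. y \<squnion>\<^sub>T w) F" shows "decidable (\<lambda>y. y \<squnion>\<^sub>T w) (\<lambda>y n. w (F y n))"
proof -
  have eq: "w (F y n) = (y \<squnion>\<^sub>T w) (2 * F y n + 1)" for y n by (simp add: join_def)
  have "decidable (\<lambda>y. y \<squnion>\<^sub>T w) (\<lambda>y n. (y \<squnion>\<^sub>T w) (2 * F y n + 1))"
    by (intro decidable_oracle computable_intros assms)
  then show ?thesis by (simp only: eq)
qed

primrec substitute :: "program \<Rightarrow> program \<Rightarrow> program" where
  "substitute q Zero = Zero"
| "substitute q Succ = Succ"
| "substitute q Fst = Fst"
| "substitute q Snd = Snd"
| "substitute q Query = q"
| "substitute q (Tuple p p') = Tuple (substitute q p) (substitute q p')"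
| "substitute q (Compose p p') = Compose (substitute q p) (substitute q p')"
| "substitute q (Prim_Rec p p') = Prim_Rec (substitute q p) (substitute q p')"
| "substitute q (Minimize p) = Minimize (substitute q p)"

lemma run_substitute:
  assumes "\<And>n. run X q n = Some (of_bool (Y n))"
  shows "run X (substitute q p) = run Y p"
proof -
  have "run X q = run Y Query" using assms by (simp add: fun_eq_iff)
  then show ?thesis by (induction p) (simp_all cong: if_cong)
qed

text \<open>The domain has to be transformed correctly too, so the oracle of the given program is replaced
inside the program: each query to \<open>even_part v \<squnion>\<^sub>T w\<close> is answered from
\<open>v \<squnion>\<^sub>T w\<close>.\<close>

lemma computes_even_part:
  assumes "computes w g"
  shows "computes w (\<lambda>v. g (even_part v))"
proof -
  have "decidable (\<lambda>v. v \<squnion>\<^sub>T w) (\<lambda>v n. (even_part v \<squnion>\<^sub>T w) n)"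
    unfolding even_part_def
    by (intro computable_intros decidable_join_left decidable_join_right)
  then obtain q where q: "\<And>v n. run (v \<squnion>\<^sub>T w) q n = Some (of_bool ((even_part v \<squnion>\<^sub>T w) n))"
    unfolding decidable_def computable_def by blast
  obtain p where p: "\<And>x. x \<in> dom g \<longleftrightarrow> (\<forall>n. run (x \<squnion>\<^sub>T w) p n \<noteq> None)"
    "\<And>x y n. g x = Some y \<Longrightarrow> run (x \<squnion>\<^sub>T w) p n = Some (of_bool (y n))"
    using assms unfolding computes_def by blast
  have "run (v \<squnion>\<^sub>T w) (substitute q p) = run (even_part v \<squnion>\<^sub>T w) p" for v
    using q by (rule run_substitute)
  then show ?thesis unfolding computes_def
    using p by (intro exI[of _ "substitute q p"]) (simp add: dom_def)
qed

lemma probabilistic_of_positive_inversion: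
  assumes "positive_inversion f g"
  shows "probabilistic_inversion f (\<lambda>v. g (even_part v))"
proof -
  define A where "A = {y. \<exists>x. g y = Some x \<and> f x = y}"
  have pos: "0 < measure uniform A" using assms by (simp add: positive_inversion_def A_def)
  then have A: "A \<in> sets uniform" using measure_notin_sets by fastforce
  have "{y \<squnion>\<^sub>T r | y r. \<exists>x. g (even_part (y \<squnion>\<^sub>T r)) = Some x \<and> f x = y} = even_part -` A \<inter> space uniform"
  proof -
    have "\<exists>y r. v = y \<squnion>\<^sub>T r \<and> y = even_part v" for v
      by (intro exI[of _ "even_part v"] exI[of _ "\<lambda>n. v (2 * n + 1)"])
        (auto simp: join_def even_part_def fun_eq_iff)
    then show ?thesis unfolding A_def by (fastforce)
  qed
  moreover have "measure uniform (even_part -` A \<inter> space uniform) = measure uniform A"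
    using measure_distr[OF measurable_even_part A] by (simp add: distr_even_part)
  ultimately show ?thesis using pos by (simp add: probabilistic_inversion_def)
qed

text \<open>Stages of an enumeration of the halting problem. At stage \<open>t\<close> only the table with code
\<open>t\<close> is inspected, so this property is not monotone in \<open>t\<close>.\<close>

definition halts_within :: "nat \<Rightarrow> nat \<Rightarrow> bool" where
  "halts_within e t \<longleftrightarrow> (\<exists>v<t. derives (\<lambda>_. False) t e e v)"

lemma halting_problem_iff: "halting_problem e \<longleftrightarrow> (\<exists>t. halts_within e t)"
proof -
  obtain p where p: "program_code p = e" using program_code_surj by blast
  have "halting_problem e \<longleftrightarrow> (\<exists>v. run (\<lambda>_. False) p e = Some v)"
    unfolding halting_problem_def p[symmetric] by (auto simp: program_code_inject)
  also have "\<dots> \<longleftrightarrow> (\<exists>t. halts_within e t)"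
    unfolding run_iff_derives halts_within_def p
    using entry_less(3) unfolding derives_def by metis
  finally show ?thesis .
qed

lemma decidable_halts_within [computable_intros]:
  assumes "computable X F" "computable X G"
  shows "decidable X (\<lambda>i n. halts_within (F i n) (G i n))"
  unfolding halts_within_def
  by (intro computable_intros decidable_derives computable_compose[OF assms(1)] computable_compose[OF assms(2)] assms)

text \<open>An existential question about \<open>n\<close> is turned into the halting of a program that has \<open>n\<close> built
in and ignores its input; on its own code in particular it halts if and only if the answer is yes. The
code of that program is a computable function of \<open>n\<close>.\<close>

lemma decidable_exists_of_halting:
  assumes H: "decidable X (\<lambda>i. halting_problem)"
    and P: "decidable (\<lambda>_::unit. \<lambda>_. False) (\<lambda>_ z. P (pfst z) (psnd z))"
    and F: "computable X F"
  shows "decidable X (\<lambda>i n. \<exists>m. P (F i n) m)"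
proof -
  have "decidable (\<lambda>_::unit. \<lambda>_. False) (\<lambda>_ z. \<not> P (pfst z) (psnd z))"
    using P by (rule decidable_not)
  then obtain p where p: "\<And>z. run (\<lambda>_. False) p z = Some (of_bool (\<not> P (pfst z) (psnd z)))"
    unfolding decidable_def computable_def by blast
  define const where "const n = ((Compose Succ) ^^ n) Zero" for n
  define code where "code n = 6 + 4 * prod_encode (program_code (Minimize p),
      rec_nat 0 (\<lambda>_ r. 6 + 4 * prod_encode (1, r)) n)" for n
  have run_const: "run Y (const n) k = Some n" for Y n k
    unfolding const_def by (induction n arbitrary: k) auto
  have "program_code (const n) = rec_nat 0 (\<lambda>_ r. 6 + 4 * prod_encode (1, r)) n" for n
    unfolding const_def by (induction n) auto
  then have code: "program_code (Compose (Minimize p) (const n)) = code n" for n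
    unfolding code_def by simp
  have "halting_problem (code n) \<longleftrightarrow> (\<exists>m. P n m)" for n
  proof -
    have "halting_problem (code n) \<longleftrightarrow> run (\<lambda>_. False) (Compose (Minimize p) (const n)) (code n) \<noteq> None"
      unfolding halting_problem_def code[symmetric] by (auto simp: program_code_inject simp del: program_code.simps)
    also have "\<dots> \<longleftrightarrow> run (\<lambda>_. False) (Minimize p) n \<noteq> None"
      by (simp add: run_const)
    also have "\<dots> \<longleftrightarrow> (\<exists>m. P n m)"
      by (auto simp: p)
    finally show ?thesis .
  qed
  moreover have "decidable X (\<lambda>i n. halting_problem (code (F i n)))"
    unfolding code_def by (intro decidable_compose[OF H] computable_intros F)
  ultimately show ?thesis by simp
qed

section \<open>A function whose inversion reveals the halting problem\<close>

lemma sum_of_bool_lessThan: "(\<Sum>c<b. of_bool (P c)) = card {c::nat. c < b \<and> P c}"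
  by (simp add: Int_def lessThan_def)

definition enters :: "nat \<Rightarrow> nat \<Rightarrow> bool" where
  "enters e s \<longleftrightarrow> halts_within e s \<and> (\<forall>t<s. \<not> halts_within e t)"

lemma enters_unique: "enters e s \<Longrightarrow> enters e t \<Longrightarrow> s = t"
  unfolding enters_def by (metis nat_neq_iff)

lemma halting_problem_iff_enters: "halting_problem e \<longleftrightarrow> (\<exists>s. enters e s)"
  unfolding halting_problem_iff enters_def using exists_least_iff[of "halts_within e"] by blast

text \<open>The odd bits of \<open>x\<close> are the real \<open>z\<close> of the introduction, the even bits are \<open>y\<close>. At
most one position of the output is reserved for each bit \<open>z(n)\<close>, and which one becomes known only
when \<open>n\<close> enters the halting problem.\<close>

definition puzzle :: "cantor \<Rightarrow> cantor" where
  "puzzle x = (\<lambda>m. if enters (pfst m) (psnd m) then x (2 * pfst m + 1) else x (2 * m))"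

lemma total_computable_iff: "total_computable f \<longleftrightarrow> decidable (\<lambda>x. x) f"
  unfolding total_computable_def decidable_def computable_def ..

lemma total_computable_puzzle: "total_computable puzzle"
  unfolding total_computable_iff puzzle_def enters_def
  by (intro computable_intros decidable_oracle[where X = "\<lambda>x. x"])

lemma surj_puzzle: "range puzzle = UNIV"
proof (intro equalityI subset_UNIV subsetI)
  fix y :: cantor
  define x where "x n = (if even n then y (n div 2)
      else y (prod_encode (n div 2, THE s. enters (n div 2) s)))" for n
  have "puzzle x m = y m" for m
  proof (cases "enters (pfst m) (psnd m)")
    case True
    then have "(THE s. enters (pfst m) s) = psnd m"
      using enters_unique by blast
    then show ?thesis using True by (simp add: puzzle_def x_def)
  qed (simp add: puzzle_def x_def)
  then have "puzzle x = y" by (rule ext)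
  then show "y \<in> range puzzle" by blast
qed

text \<open>In the proof, \<open>S\<close> is the set of inputs on which the inversion succeeds, and \<open>N\<close> is a cylinder
in which \<open>S\<close> has density above 3/4. Within \<open>N\<close>, the event \<open>answered n u\<close> says that the
inversion outputs the bit \<open>2 * n + 1\<close> by stage \<open>u\<close>, and \<open>yes n u\<close> is that
bit. If \<open>answered n u\<close> fills more than half of \<open>N\<close> and \<open>n\<close> entered later than
\<open>u\<close> allows, then the inversion would fail on half of \<open>answered n u\<close>, hence on more than a
quarter of \<open>N\<close>.\<close>

lemma halting_reducible_of_probabilistic_inversion:
  assumes "computes w g" "probabilistic_inversion puzzle g"
  shows "halting_problem \<le>\<^sub>T w"
proof -
  define S where "S = {y \<squnion>\<^sub>T r | y r. \<exists>x. g (y \<squnion>\<^sub>T r) = Some x \<and> puzzle x = y}"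
  have S_pos: "0 < measure uniform S" using assms(2) by (simp add: probabilistic_inversion_def S_def)
  then have S_sets: "S \<in> sets uniform" using measure_notin_sets by fastforce
  obtain p where p: "\<And>v x n. g v = Some x \<Longrightarrow> run (v \<squnion>\<^sub>T w) p n = Some (of_bool (x n))"
    using assms(1) unfolding computes_def by blast
  define e where "e = program_code p"
  obtain L and b :: nat where b: "b < 2 ^ L"
    and dense: "3 / 4 / 2 ^ L < measure uniform {v \<in> S. \<forall>j<L. v j = bit b j}"
    using dense_cylinder[OF S_sets S_pos, of "3 / 4"] by auto
  define N where "N = {v. \<forall>j\<in>{..<L}. v j = bit b j}"
  have N_sets [measurable]: "N \<in> sets uniform" unfolding N_def by (rule cylinder_sets) simp
  have prob_N: "measure uniform N = 1 / 2 ^ L" unfolding N_def by (subst cylinder_prob) simp_all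
  have dense': "3 / 4 / 2 ^ L < measure uniform (S \<inter> N)"
  proof -
    have "{v \<in> S. \<forall>j<L. v j = bit b j} = S \<inter> N" unfolding N_def by blast
    then show ?thesis using dense by simp
  qed
  note [measurable] = S_sets
  define answered where "answered n u v \<longleftrightarrow> (\<forall>j<L. v j = bit b j) \<and>
      (\<exists>t<u. \<exists>a<2. derives (v \<squnion>\<^sub>T w) t e (2 * n + 1) a)" for n u v
  define yes where "yes n u v \<longleftrightarrow> (\<exists>t<u. derives (v \<squnion>\<^sub>T w) t e (2 * n + 1) 1)" for n u v
  \<comment> \<open>Deciding membership in the cylinder takes \<open>L\<close> bits, whence the bound \<open>L + u\<close>.\<close>
  have depends_t: "depends_below (L + u) (\<lambda>v. derives (v \<squnion>\<^sub>T w) t e n a)" if "t < u" for t u n a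
    using that by (intro depends_below_mono[OF depends_below_derives_join]) simp
  have depends_answered: "depends_below (L + u) (answered n u)" for n u
    unfolding depends_below_def
  proof (intro allI impI)
    fix x y :: cantor assume xy: "\<forall>j<L + u. x j = y j"
    have "derives (x \<squnion>\<^sub>T w) t e n a = derives (y \<squnion>\<^sub>T w) t e n a" if "t < u" for t n a
      using depends_belowD[OF depends_t[OF that]] xy by blast
    then show "answered n u x = answered n u y"
      unfolding answered_def using xy by (auto cong: conj_cong)
  qed
  have depends_yes: "depends_below (L + u) (yes n u)" for n u
    unfolding depends_below_def
  proof (intro allI impI)
    fix x y :: cantor assume xy: "\<forall>j<L + u. x j = y j"
    have "derives (x \<squnion>\<^sub>T w) t e n a = derives (y \<squnion>\<^sub>T w) t e n a" if "t < u" for t n a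
      using depends_belowD[OF depends_t[OF that]] xy by blast
    then show "yes n u x = yes n u y"
      unfolding yes_def by auto
  qed
  define strings where "strings n u = {c::nat. c < 2 ^ (L + u) \<and> answered n u (bit c)}" for n u
  define enough where "enough n u \<longleftrightarrow> 2 ^ u < 2 * (\<Sum>c<(2::nat) ^ (L + u). of_bool (answered n u (bit c)) :: nat)" for n u
  have enough: "enough n u \<longleftrightarrow> 1 / 2 / 2 ^ L < measure uniform {v. answered n u v}" for n u
  proof -
    have "enough n u \<longleftrightarrow> real (2 ^ u) < real (2 * card (strings n u))"
      unfolding enough_def strings_def sum_of_bool_lessThan of_nat_less_iff ..
    also have "\<dots> \<longleftrightarrow> 1 / 2 / 2 ^ L < measure uniform {v. answered n u v}"
      unfolding prob_depends_below[OF depends_answered] strings_def[symmetric]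
      by (simp add: field_simps power_add)
    finally show ?thesis .
  qed
  have answered_sets [measurable]: "{v. answered n u v} \<in> sets uniform" for n u
    by (rule sets_depends_below[OF depends_answered])
  have ex_enough: "\<exists>u. enough n u" for n
  proof -
    have "S \<inter> N \<subseteq> (\<Union>u. {v. answered n u v})"
    proof
      fix v assume v: "v \<in> S \<inter> N"
      then obtain x where "g v = Some x" unfolding S_def by blast
      then have "run (v \<squnion>\<^sub>T w) p (2 * n + 1) = Some (of_bool (x (2 * n + 1)))" by (rule p)
      then obtain t where "derives (v \<squnion>\<^sub>T w) t e (2 * n + 1) (of_bool (x (2 * n + 1)))"
        unfolding run_iff_derives e_def by blast
      then have "answered n (Suc t) v"
        using v unfolding answered_def N_def
        by (intro conjI exI[of _ t] exI[of _ "of_bool (x (2 * n + 1))"]) auto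
      then show "v \<in> (\<Union>u. {v. answered n u v})" by blast
    qed
    then have "measure uniform (S \<inter> N) \<le> measure uniform (\<Union>u. {v. answered n u v})"
      by (intro uniform.finite_measure_mono) auto
    moreover have "(\<lambda>u. measure uniform {v. answered n u v}) \<longlonglongrightarrow> measure uniform (\<Union>u. {v. answered n u v})"
    proof (intro uniform.finite_Lim_measure_incseq incseq_SucI)
      show "{v. answered n u v} \<subseteq> {v. answered n (Suc u) v}" for u
        unfolding answered_def using less_SucI by blast
    qed auto
    moreover have "1 / 2 / 2 ^ L \<le> (3 / 4 / 2 ^ L :: real)" by (simp add: field_simps)
    ultimately have "\<forall>\<^sub>F u in sequentially. 1 / 2 / 2 ^ L < measure uniform {v. answered n u v}"
      using dense' by (intro order_tendstoD(1)) auto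
    then show ?thesis unfolding enough by (auto simp: eventually_sequentially)
  qed
  have late: "s < L + u" if "enough n u" "enters n s" for n u s
  proof (rule ccontr)
    assume "\<not> s < L + u"
    \<comment> \<open>The position, in the joined input of the inversion, of the output bit reserved for \<open>n\<close>.\<close>
    define k where "k = 2 * prod_encode (n, s)"
    have k: "L + u \<le> k"
      using \<open>\<not> s < L + u\<close> le_prod_encode_2[of s n] unfolding k_def by linarith
    have correct: "v k = yes n u v" if "v \<in> S" "answered n u v" for v
    proof -
      obtain y r x where v: "v = y \<squnion>\<^sub>T r" and x: "g v = Some x" "puzzle x = y"
        using \<open>v \<in> S\<close> unfolding S_def by blast
      have "v k = puzzle x (prod_encode (n, s))" unfolding v x k_def by (simp add: join_def)
      then have vk: "v k = x (2 * n + 1)" using \<open>enters n s\<close> by (simp add: puzzle_def)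
      have run: "run (v \<squnion>\<^sub>T w) p (2 * n + 1) = Some (of_bool (x (2 * n + 1)))" using p x by blast
      have val: "of_bool (x (2 * n + 1)) = a" if "derives (v \<squnion>\<^sub>T w) t e (2 * n + 1) a" for t a
      proof -
        have "run (v \<squnion>\<^sub>T w) p (2 * n + 1) = Some a" using that unfolding run_iff_derives e_def by blast
        then show ?thesis using run by simp
      qed
      obtain t a where "t < u" "derives (v \<squnion>\<^sub>T w) t e (2 * n + 1) a"
        using \<open>answered n u v\<close> unfolding answered_def by blast
      then have "t < u \<and> derives (v \<squnion>\<^sub>T w) t e (2 * n + 1) (of_bool (x (2 * n + 1)))"
        by (simp only: val)
      moreover have "x (2 * n + 1)" if "derives (v \<squnion>\<^sub>T w) t e (2 * n + 1) 1" for t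
        using val[OF that] by (simp only: of_bool_eq_1_iff)
      ultimately have "x (2 * n + 1) \<longleftrightarrow> yes n u v"
        unfolding yes_def by (cases "x (2 * n + 1)") (simp_all only: of_bool_eq, blast+)
      then show ?thesis unfolding vk .
    qed
    note later = prob_predict_later_bit[OF depends_answered depends_yes k, of n n]
    have "S \<inter> N \<subseteq> (N - {v. answered n u v}) \<union> {v. answered n u v \<and> v k = yes n u v}"
      using correct by blast
    then have "measure uniform (S \<inter> N) \<le>
        measure uniform ((N - {v. answered n u v}) \<union> {v. answered n u v \<and> v k = yes n u v})"
      using later(1) by (intro uniform.finite_measure_mono) auto
    also have "\<dots> \<le> measure uniform (N - {v. answered n u v}) + measure uniform {v. answered n u v \<and> v k = yes n u v}"
      using later(1) by (intro measure_Un_le) auto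
    also have "measure uniform (N - {v. answered n u v}) = measure uniform N - measure uniform {v. answered n u v}"
      by (intro uniform.finite_measure_Diff N_sets answered_sets) (simp add: answered_def N_def subset_iff)
    finally have "measure uniform (S \<inter> N) \<le> 1 / 2 ^ L - measure uniform {v. answered n u v} / 2"
      unfolding later(2) prob_N by simp
    moreover have "1 / 2 / 2 ^ L < measure uniform {v. answered n u v}"
      using \<open>enough n u\<close> enough by blast
    ultimately show False using dense' by simp
  qed
  \<comment> \<open>The least sufficient stage exists for every input, and finding it only requires counting strings.\<close>
  define bound where "bound n = L + (LEAST u. enough n u)" for n
  have halting: "halting_problem n \<longleftrightarrow> (\<exists>s<bound n. halts_within n s)" for n
  proof
    assume "halting_problem n"
    then obtain s where s: "enters n s" unfolding halting_problem_iff_enters ..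
    have "enough n (LEAST u. enough n u)" using ex_enough by (rule LeastI_ex)
    then have "s < bound n" unfolding bound_def using s by (rule late)
    then show "\<exists>s<bound n. halts_within n s" using s unfolding enters_def by blast
  qed (auto simp: halting_problem_iff)
  have query_w: "decidable (\<lambda>_::unit. w) (\<lambda>i n. w (F i n))" if "computable (\<lambda>_::unit. w) F" for F
    using that by (rule decidable_oracle)
  have "decidable (\<lambda>_::unit. w) (\<lambda>_ n. \<exists>s<bound n. halts_within n s)"
    unfolding bound_def
    apply (intro computable_intros computable_Least ex_enough)
    unfolding enough_def answered_def
    by (intro computable_intros decidable_derives query_w)
  then show ?thesis
    unfolding halting[symmetric] decidable_def computable_def turing_reducible_def by simp
qed

section \<open>Inverting with the help of the halting problem\<close>

text \<open>The string \<open>c\<close> has not been refuted as the beginning of a preimage of \<open>y\<close>: whatever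
the program \<open>e\<close> outputs on it within \<open>m\<close> stages agrees with \<open>y\<close>.\<close>

definition consistent :: "nat \<Rightarrow> cantor \<Rightarrow> nat \<Rightarrow> nat \<Rightarrow> bool" where
  "consistent e y c m \<longleftrightarrow> (\<forall>t<m. \<forall>n<t. \<forall>v<t. derives (bit c) t e n v \<longrightarrow> v = of_bool (y n))"

text \<open>This is the clopen approximation, at stage \<open>k + s\<close>, of the image of the cylinder given by the
string \<open>a\<close> of length \<open>k\<close>. Reduction modulo \<open>2 ^ k\<close> takes the first \<open>k\<close>
bits. Offsetting the stage by \<open>k\<close> ensures that only strings at least as long as \<open>a\<close> are tried.\<close>

definition extendable :: "nat \<Rightarrow> nat \<Rightarrow> nat \<Rightarrow> nat \<Rightarrow> cantor \<Rightarrow> bool" where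
  "extendable e k a s y \<longleftrightarrow> (\<exists>c<2 ^ (k + s). c mod 2 ^ k = a \<and> consistent e y c (k + s))"

lemma depends_below_extendable: "depends_below (k + s) (extendable e k a s)"
proof -
  have "consistent e x c (k + s) = consistent e y c (k + s)" if "\<forall>j<k + s. x j = y j" for x y c
    unfolding consistent_def using that less_trans by auto
  then show ?thesis unfolding depends_below_def extendable_def by (metis (no_types, lifting))
qed

lemma extendable_Suc:
  assumes "extendable e k a (Suc s) y" shows "extendable e k a s y"
proof -
  obtain c where c: "c < 2 ^ (k + Suc s)" "c mod 2 ^ k = a" "consistent e y c (k + Suc s)"
    using assms unfolding extendable_def by blast
  define c' where "c' = c mod 2 ^ (k + s)"
  have "c' < 2 ^ (k + s)" unfolding c'_def by simp
  moreover have "c' mod 2 ^ k = a"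
    unfolding c'_def c(2)[symmetric] by (rule mod_mod_cancel) (simp add: power_add)
  moreover have "consistent e y c' (k + s)"
    unfolding consistent_def
  proof (intro allI impI)
    fix t n v assume t: "t < k + s" "n < t" "v < t" "derives (bit c') t e n v"
    have "bit c' j = bit c j" if "j < t" for j
      using that t(1) by (simp add: c'_def bit_take_bit_iff flip: take_bit_eq_mod)
    then have "derives (bit c) t e n v" using t(4) derives_cong[of t "bit c'" "bit c"] by blast
    moreover have "t < k + Suc s" using t(1) by simp
    ultimately show "v = of_bool (y n)" using c(3) t(2,3) unfolding consistent_def by blast
  qed
  ultimately show ?thesis unfolding extendable_def by blast
qed

lemma extendable_antimono: "r \<le> s \<Longrightarrow> extendable e k a s y \<Longrightarrow> extendable e k a r y"
  by (induction s rule: dec_induct) (auto intro: extendable_Suc)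

text \<open>If each of the two extensions of \<open>a\<close> by one bit were refuted at some stage, then by
monotonicity both would be refuted at a common stage, and so would \<open>a\<close>.\<close>

lemma extendable_step:
  assumes "\<forall>s. extendable e k a s y" "\<not> extendable e (Suc k) a r y"
  shows "extendable e (Suc k) (a + 2 ^ k) s y"
proof -
  have split: "extendable e (Suc k) a s y \<or> extendable e (Suc k) (a + 2 ^ k) s y" for s
  proof -
    obtain c where c: "c < 2 ^ (Suc k + s)" "c mod 2 ^ k = a" "consistent e y c (Suc k + s)"
      using assms(1)[rule_format, of "Suc s"] unfolding extendable_def by auto
    have "c mod 2 ^ Suc k = 2 ^ k * (c div 2 ^ k mod 2) + c mod 2 ^ k"
      using mod_mult2_eq[of c "2 ^ k" 2] by (simp add: mult.commute)
    then have "c mod 2 ^ Suc k = a \<or> c mod 2 ^ Suc k = a + 2 ^ k"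
      using c(2) by (cases "c div 2 ^ k mod 2 = 0") auto
    then show ?thesis using c unfolding extendable_def by blast
  qed
  have "extendable e (Suc k) (a + 2 ^ k) (max r s) y"
    using split[of "max r s"] extendable_antimono assms(2) max.cobounded1 by blast
  then show ?thesis using extendable_antimono max.cobounded2 by blast
qed

lemma decidable_extendable:
  assumes "decidable X (\<lambda>i z. Y i (pfst z) (psnd z))"
    "computable X K" "computable X A" "computable X S"
  shows "decidable X (\<lambda>i n. extendable e (K i n) (A i n) (S i n) (Y i n))"
  unfolding extendable_def consistent_def
  apply (intro computable_intros assms decidable_derives computable_compose[OF assms(2)]
      computable_compose[OF assms(3)] computable_compose[OF assms(4)])
  subgoal premises p
  proof -
    have eq: "(v = of_bool b) \<longleftrightarrow> (b \<longrightarrow> v = 1) \<and> (\<not> b \<longrightarrow> v = 0)" for v :: nat and b by auto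
    show ?thesis
    by (intro computable_intros assms decidable_derives computable_compose[OF assms(2)]
      computable_compose[OF assms(3)] computable_compose[OF assms(4)] decidable_compose2[OF assms(1)])
  qed
  done

definition extensions :: "nat \<Rightarrow> nat \<Rightarrow> nat \<Rightarrow> nat \<Rightarrow> nat" where
  "extensions e k a s = (\<Sum>b<(2::nat) ^ (k + s). of_bool (extendable e k a s (bit b)))"

lemma sets_extendable: "{y. extendable e k a s y} \<in> sets uniform"
  by (rule sets_depends_below[OF depends_below_extendable])

lemma prob_extendable: "measure uniform {y. extendable e k a s y} = extensions e k a s / 2 ^ (k + s)"
  unfolding prob_depends_below[OF depends_below_extendable] extensions_def sum_of_bool_lessThan ..

text \<open>An inequality between measures of clopen sets with the denominators cleared, so that it is about
natural numbers; \<open>unsettled_iff\<close> is the form that it stands for. The tolerance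
\<open>1 / 2 ^ (2 * k + d)\<close> is chosen such that its sum over all \<open>2 ^ k\<close> strings of all lengths
\<open>k\<close> is \<open>2 / 2 ^ d\<close>.\<close>

definition unsettled :: "nat \<Rightarrow> nat \<Rightarrow> nat \<Rightarrow> nat \<Rightarrow> nat \<Rightarrow> bool" where
  "unsettled e d k a N \<longleftrightarrow> (\<exists>s. extensions e k a (N + s) * 2 ^ (2 * k + d) + 2 ^ (k + N + s)
     < extensions e k a N * 2 ^ (s + (2 * k + d)))"

lemma unsettled_iff: "unsettled e d k a N \<longleftrightarrow> (\<exists>s.
   measure uniform {y. extendable e k a (N + s) y} + 1 / 2 ^ (2 * k + d) <
   measure uniform {y. extendable e k a N y})"
proof -
  have "n * 2 ^ r + 2 ^ (k + N + s) < m * 2 ^ (s + r) \<longleftrightarrow>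
      n / 2 ^ (k + (N + s)) + 1 / 2 ^ r < m / (2 ^ (k + N) :: real)" for n m r s :: nat
  proof -
    have "n * 2 ^ r + 2 ^ (k + N + s) < m * 2 ^ (s + r) \<longleftrightarrow>
       real (n * 2 ^ r + 2 ^ (k + N + s)) < real (m * 2 ^ (s + r))" by (rule of_nat_less_iff[symmetric])
    also have "\<dots> \<longleftrightarrow> n / 2 ^ (k + (N + s)) + 1 / 2 ^ r < m / (2 ^ (k + N) :: real)"
    proof -
      let ?D = "2 ^ (k + N + s + r) :: real"
      have "(n / 2 ^ (k + (N + s)) + 1 / 2 ^ r) * ?D = real (n * 2 ^ r + 2 ^ (k + N + s))"
        "(m / 2 ^ (k + N)) * ?D = real (m * 2 ^ (s + r))"
        by (simp_all add: power_add ring_distribs)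
      then show ?thesis by (metis mult_less_cancel_right_pos zero_less_power zero_less_numeral)
    qed
    finally show ?thesis .
  qed
  then show ?thesis unfolding unsettled_def prob_extendable by simp
qed

definition settle :: "nat \<Rightarrow> nat \<Rightarrow> nat \<Rightarrow> nat \<Rightarrow> nat" where
  "settle e d k a = (LEAST N. \<not> unsettled e d k a N)"

lemma LIMSEQ_prob_extendable:
  "(\<lambda>s. measure uniform {y. extendable e k a s y}) \<longlonglongrightarrow> measure uniform {y. \<forall>s. extendable e k a s y}"
proof -
  have "(\<lambda>s. measure uniform {y. extendable e k a s y}) \<longlonglongrightarrow> measure uniform (\<Inter>s. {y. extendable e k a s y})"
    using sets_extendable
    by (intro uniform.finite_Lim_measure_decseq) (auto intro!: decseq_SucI extendable_Suc)
  then show ?thesis by (simp add: Collect_all_eq)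
qed

lemma sets_always_extendable: "{y. \<forall>s. extendable e k a s y} \<in> sets uniform"
  unfolding Collect_all_eq using sets_extendable by (intro sets.countable_INT) auto

text \<open>The measures decrease to a limit, so from some stage on all further drops are small.\<close>

lemma ex_settled: "\<exists>N. \<not> unsettled e d k a N"
proof -
  let ?\<mu> = "\<lambda>s. measure uniform {y. extendable e k a s y}"
  let ?l = "measure uniform {y. \<forall>s. extendable e k a s y}"
  have "\<forall>\<^sub>F N in sequentially. ?\<mu> N < ?l + 1 / 2 ^ (2 * k + d)"
    by (intro order_tendstoD(2)[OF LIMSEQ_prob_extendable]) simp
  then obtain N where "?\<mu> N < ?l + 1 / 2 ^ (2 * k + d)"
    by (auto simp: eventually_sequentially)
  moreover have "?l \<le> ?\<mu> s" for s
    using sets_extendable by (intro uniform.finite_measure_mono) auto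
  ultimately have "\<not> ?\<mu> (N + s) + 1 / 2 ^ (2 * k + d) < ?\<mu> N" for s
    by (smt (verit))
  then show ?thesis unfolding unsettled_iff by blast
qed

lemma prob_misleading:
  "measure uniform ({y. extendable e k a (settle e d k a) y} - {y. \<forall>s. extendable e k a s y})
    \<le> 1 / 2 ^ (2 * k + d)"
proof -
  let ?N = "settle e d k a"
  let ?\<mu> = "\<lambda>s. measure uniform {y. extendable e k a s y}"
  let ?l = "measure uniform {y. \<forall>s. extendable e k a s y}"
  have "\<not> unsettled e d k a ?N" unfolding settle_def using ex_settled by (rule LeastI_ex)
  then have "?\<mu> ?N - 1 / 2 ^ (2 * k + d) \<le> ?\<mu> (s + ?N)" for s
    unfolding unsettled_iff by (auto simp: not_less add.commute algebra_simps)
  then have "?\<mu> ?N - 1 / 2 ^ (2 * k + d) \<le> ?l"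
    by (intro LIMSEQ_le_const[OF LIMSEQ_ignore_initial_segment[OF LIMSEQ_prob_extendable, of _ _ _ ?N]]) blast
  moreover have "measure uniform ({y. extendable e k a ?N y} - {y. \<forall>s. extendable e k a s y}) = ?\<mu> ?N - ?l"
    using sets_extendable sets_always_extendable by (intro uniform.finite_measure_Diff) auto
  ultimately show ?thesis by simp
qed

lemma computable_extensions:
  assumes "computable X K" "computable X A" "computable X S"
  shows "computable X (\<lambda>i n. extensions e (K i n) (A i n) (S i n))"
  unfolding extensions_def
  by (intro computable_intros decidable_extendable assms computable_compose[OF assms(1)]
      computable_compose[OF assms(2)] computable_compose[OF assms(3)])

lemma decidable_unsettled:
  assumes H: "decidable X (\<lambda>i. halting_problem)"
    and "computable X K" "computable X A" "computable X N"
  shows "decidable X (\<lambda>i n. unsettled e d (K i n) (A i n) (N i n))"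
proof -
  \<comment> \<open>The three parameters are packed into one number, as the existential question takes a single one.\<close>
  define R where "R z s \<longleftrightarrow>
      extensions e (pfst z) (pfst (psnd z)) (psnd (psnd z) + s) * 2 ^ (2 * pfst z + d)
        + 2 ^ (pfst z + psnd (psnd z) + s)
      < extensions e (pfst z) (pfst (psnd z)) (psnd (psnd z)) * 2 ^ (s + (2 * pfst z + d))" for z s
  have "decidable (\<lambda>_::unit. \<lambda>_. False) (\<lambda>_ z. R (pfst z) (psnd z))"
    unfolding R_def by (intro computable_intros computable_extensions)
  then have "decidable X (\<lambda>i n. \<exists>s. R (prod_encode (K i n, prod_encode (A i n, N i n))) s)"
    by (intro decidable_exists_of_halting[OF H] computable_intros assms)
  then show ?thesis unfolding unsettled_def R_def by simp
qed

lemma computable_settle: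
  assumes H: "decidable X (\<lambda>i. halting_problem)" and "computable X K" "computable X A"
  shows "computable X (\<lambda>i n. settle e d (K i n) (A i n))"
  unfolding settle_def
  by (intro computable_Least ex_settled computable_intros decidable_unsettled assms
      computable_compose[OF assms(2)] computable_compose[OF assms(3)])

text \<open>The first \<open>k\<close> bits of the leftmost path, according to the settled approximations. If the
extension by 0 is rejected, then the extension by 1 is taken without test.\<close>

definition prefix_code :: "nat \<Rightarrow> nat \<Rightarrow> cantor \<Rightarrow> nat \<Rightarrow> nat" where
  "prefix_code e d y = rec_nat 0 (\<lambda>k a. if extendable e (Suc k) a (settle e d (Suc k) a) y then a else a + 2 ^ k)"

definition preimage :: "nat \<Rightarrow> nat \<Rightarrow> cantor \<Rightarrow> cantor" where
  "preimage e d y k \<longleftrightarrow> \<not> extendable e (Suc k) (prefix_code e d y k) (settle e d (Suc k) (prefix_code e d y k)) y"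

lemma prefix_code_Suc: "prefix_code e d y (Suc k) = prefix_code e d y k + (if preimage e d y k then 2 ^ k else 0)"
  by (simp add: prefix_code_def preimage_def)

lemma prefix_code_0: "prefix_code e d y 0 = 0" by (simp add: prefix_code_def)

lemma prefix_code_less: "prefix_code e d y k < 2 ^ k"
  by (induction k) (auto simp: prefix_code_0 prefix_code_Suc)

lemma bit_prefix_code: "j < k \<Longrightarrow> bit (prefix_code e d y k) j = preimage e d y j"
proof (induction k)
  case (Suc k)
  have low: "bit (a + 2 ^ k) j \<longleftrightarrow> bit a j" if "j < k" for a :: nat
  proof -
    have "(2::nat) ^ k = 2 * 2 ^ (k - Suc j) * 2 ^ j"
      using that by (simp flip: power_add power_Suc)
    then have "(a + 2 ^ k) div 2 ^ j = a div 2 ^ j + 2 * 2 ^ (k - Suc j)"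
      by (simp only: div_mult_self1) simp
    then show ?thesis by (simp add: bit_iff_odd)
  qed
  show ?case
  proof (cases "j < k")
    case True
    then show ?thesis using Suc.IH low by (simp add: prefix_code_Suc)
  next
    case False
    then have "j = k" using Suc.prems by simp
    then show ?thesis using prefix_code_less[of e d y k] by (simp add: prefix_code_Suc bit_iff_odd div_add_self2)
  qed
qed simp

text \<open>The reals for which some settled approximation disagrees with the limit of the approximations.\<close>

definition misled :: "nat \<Rightarrow> nat \<Rightarrow> cantor set" where
  "misled e d = (\<Union>k. \<Union>a\<in>{..<2 ^ k}.
     {y. extendable e k a (settle e d k a) y} - {y. \<forall>s. extendable e k a s y})"

lemma sets_misled: "misled e d \<in> sets uniform"
  unfolding misled_def using sets_extendable sets_always_extendable
  by (intro sets.countable_UN' sets.finite_UN sets.Diff) auto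

lemma prob_misled: "measure uniform (misled e d) \<le> 2 / 2 ^ d"
proof -
  define D where "D k a = {y. extendable e k a (settle e d k a) y} - {y. \<forall>s. extendable e k a s y}" for k a
  have D: "D k a \<in> sets uniform" for k a
    unfolding D_def by (intro sets.Diff sets_extendable sets_always_extendable)
  have le: "measure uniform (\<Union>a\<in>{..<2 ^ k}. D k a) \<le> (1 / 2) ^ k * (1 / 2 ^ d)" for k
  proof -
    have "measure uniform (\<Union>a\<in>{..<2 ^ k}. D k a) \<le> (\<Sum>a<2 ^ k. measure uniform (D k a))"
      using D by (intro uniform.finite_measure_subadditive_finite) auto
    also have "\<dots> \<le> (\<Sum>a<(2::nat) ^ k. 1 / 2 ^ (2 * k + d))"
      unfolding D_def by (intro sum_mono prob_misleading)
    also have "(2::real) ^ (2 * k + d) = 2 ^ k * (2 ^ k * 2 ^ d)"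
      by (simp add: power_add mult_2)
    also have "(\<Sum>a<(2::nat) ^ k. 1 / (2 ^ k * (2 ^ k * 2 ^ d) :: real)) = (1 / 2) ^ k * (1 / 2 ^ d)"
      by (simp add: power_one_over)
    finally show ?thesis .
  qed
  have sums: "(\<lambda>k. (1 / 2) ^ k * (1 / 2 ^ d :: real)) sums (2 * (1 / 2 ^ d))"
    using geometric_sums[of "1 / 2 :: real"] by (intro sums_mult2) simp
  have summable: "summable (\<lambda>k. measure uniform (\<Union>a\<in>{..<2 ^ k}. D k a))"
    using le by (intro summable_comparison_test'[OF sums_summable[OF sums]]) simp
  have "measure uniform (misled e d) \<le> (\<Sum>k. measure uniform (\<Union>a\<in>{..<2 ^ k}. D k a))"
    unfolding misled_def D_def[symmetric] using D
    by (intro uniform.finite_measure_subadditive_countably[OF _ summable]) auto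
  also have "\<dots> \<le> (\<Sum>k. (1 / 2) ^ k * (1 / 2 ^ d))"
    using le by (intro suminf_le summable sums_summable[OF sums])
  also have "\<dots> = 2 / 2 ^ d" using sums_unique[OF sums] by simp
  finally show ?thesis .
qed

text \<open>Off the misled reals, the settled test for an extension by 0 gives the true answer, so the path
never leaves the strings that are extendable at all stages: an extension by 1 is only taken when
the one by 0 is refuted, and then \<open>extendable_step\<close> applies. Each bit of \<open>f x\<close> is output after
finitely many stages, when only a finite part of the path has been read, and so it agrees with
\<open>y\<close>.\<close>

lemma preimage_correct:
  assumes p: "\<And>x n. run x p n = Some (of_bool (f x n))"
    and y: "y \<in> range f" "y \<notin> misled (program_code p) d"
  shows "f (preimage (program_code p) d y) = y"
proof -
  define e where "e = program_code p"
  define x where "x = preimage e d y"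
  obtain z where z: "y = f z" using y(1) by blast
  have always: "\<forall>s. extendable e k (prefix_code e d y k) s y" for k
  proof (induction k)
    case 0
    have "extendable e 0 0 s y" for s
    proof -
      obtain c :: nat where c: "c < 2 ^ s" "\<forall>j<s. bit c j = z j" using string_prefix by blast
      have "v = of_bool (y n)" if "t < s" "derives (bit c) t e n v" for t n v
      proof -
        have "derives z t e n v"
          using that c(2) derives_cong[of t "bit c" z] by simp
        then have "run z p n = Some v" unfolding run_iff_derives e_def by blast
        then show ?thesis using p z by simp
      qed
      then have "consistent e y c s" unfolding consistent_def by blast
      then show ?thesis unfolding extendable_def using c(1) by auto
    qed
    then show ?case by (simp add: prefix_code_0)
  next
    case (Suc k)
    show ?case
    proof (cases "preimage e d y k")
      case True
      then show ?thesis using extendable_step[OF Suc] unfolding prefix_code_Suc preimage_def by simp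
    next
      case False
      then have "extendable e (Suc k) (prefix_code e d y k) (settle e d (Suc k) (prefix_code e d y k)) y"
        unfolding preimage_def by simp
      moreover have "prefix_code e d y k < 2 ^ Suc k" using prefix_code_less[of e d y k] by simp
      ultimately have "\<forall>s. extendable e (Suc k) (prefix_code e d y k) s y"
        using y(2) unfolding misled_def e_def by blast
      then show ?thesis using False by (simp add: prefix_code_Suc)
    qed
  qed
  have "f x m = y m" for m
  proof -
    have "run x p m = Some (of_bool (f x m))" by (rule p)
    then obtain t where t: "derives x t e m (of_bool (f x m))"
      unfolding run_iff_derives e_def by blast
    \<comment> \<open>At stage offset 0 the only string that extends the path to the required length is the path itself.\<close>
    obtain c where c: "c < 2 ^ Suc t" "c mod 2 ^ Suc t = prefix_code e d y (Suc t)" "consistent e y c (Suc t)"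
      using always[of "Suc t", rule_format, of 0] unfolding extendable_def by auto
    then have "c = prefix_code e d y (Suc t)" by simp
    then have "derives (bit c) t e m (of_bool (f x m))"
      using t bit_prefix_code[of _ "Suc t" e d y] derives_cong[of t x "bit c"] by (simp add: x_def)
    moreover from this have "m < t" "of_bool (f x m) < t" unfolding derives_def using entry_less by blast+
    ultimately have "of_bool (f x m) = (of_bool (y m) :: nat)"
      using c(3) unfolding consistent_def by blast
    then show ?thesis by (simp only: of_bool_eq_iff)
  qed
  then show ?thesis unfolding x_def e_def by (rule ext)
qed

lemma decidable_preimage:
  assumes "halting_problem \<le>\<^sub>T w"
  shows "decidable (\<lambda>y. y \<squnion>\<^sub>T w) (preimage e d)"
proof -
  obtain q where q: "\<And>n. run w q n = Some (of_bool (halting_problem n))"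
    using assms unfolding turing_reducible_def by blast
  have "decidable (\<lambda>y. y \<squnion>\<^sub>T w) (\<lambda>_. w)"
    by (rule decidable_join_right) (rule computable_id)
  then obtain r where "\<And>y n. run (y \<squnion>\<^sub>T w) r n = Some (of_bool (w n))"
    unfolding decidable_def computable_def by blast
  then have "run (y \<squnion>\<^sub>T w) (substitute r q) = run w q" for y by (rule run_substitute)
  then have H: "decidable (\<lambda>y. y \<squnion>\<^sub>T w) (\<lambda>_. halting_problem)"
    unfolding decidable_def using q by (intro computableI[of _ "substitute r q"]) simp
  have "computable (\<lambda>y. y \<squnion>\<^sub>T w) (prefix_code e d)"
    unfolding prefix_code_def
    by (intro computable_intros decidable_extendable decidable_join_left computable_settle H)
  note prefix_code = computable_compose[OF this]
  show ?thesis
    unfolding preimage_def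
    by (intro computable_intros decidable_extendable decidable_join_left computable_settle H prefix_code)
qed

lemma decidable_total_computable:
  assumes "total_computable f" "decidable X G"
  shows "decidable X (\<lambda>i. f (G i))"
proof -
  obtain p where p: "\<And>x n. run x p n = Some (of_bool (f x n))"
    using assms(1) unfolding total_computable_def by blast
  obtain q where "\<And>i n. run (X i) q n = Some (of_bool (G i n))"
    using assms(2) unfolding decidable_def computable_def by blast
  then have "run (X i) (substitute q p) = run (G i) p" for i by (rule run_substitute)
  then show ?thesis unfolding decidable_def using p by (intro computableI[of _ "substitute q p"]) simp
qed

text \<open>Functionals are continuous: each value is decided by a derivation, and each derivation by
finitely many bits.\<close>

lemma sets_decidable:
  assumes "decidable (\<lambda>y. y \<squnion>\<^sub>T w) P"
  shows "{y. P y n} \<in> sets uniform"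
proof -
  obtain p where p: "\<And>y n. run (y \<squnion>\<^sub>T w) p n = Some (of_bool (P y n))"
    using assms unfolding decidable_def computable_def by blast
  have "P y n \<longleftrightarrow> (\<exists>t. derives (y \<squnion>\<^sub>T w) t (program_code p) n 1)" for y
    unfolding run_iff_derives[symmetric] p by simp
  then have "{y. P y n} = (\<Union>t. {y. derives (y \<squnion>\<^sub>T w) t (program_code p) n 1})" by auto
  also have "\<dots> \<in> sets uniform"
    using sets_depends_below[OF depends_below_derives_join] by (intro sets.countable_UN) auto
  finally show ?thesis .
qed

lemma positive_inversion_of_halting:
  assumes "halting_problem \<le>\<^sub>T w" "total_computable f" "0 < measure uniform (range f)"
  shows "\<exists>g. computes w g \<and> positive_inversion f g"
proof -
  obtain p where p: "\<And>x n. run x p n = Some (of_bool (f x n))"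
    using assms(2) unfolding total_computable_def by blast
  define e where "e = program_code p"
  obtain d where "(1 / 2) ^ d < measure uniform (range f) / 2"
    using real_arch_pow_inv[of "measure uniform (range f) / 2" "1 / 2"] assms(3) by auto
  then have d: "2 / 2 ^ d < measure uniform (range f)" by (simp add: power_one_over field_simps)
  define g where "g = preimage e d"
  have g: "decidable (\<lambda>y. y \<squnion>\<^sub>T w) g" unfolding g_def by (rule decidable_preimage[OF assms(1)])
  have "computes w (\<lambda>y. Some (g y))"
  proof -
    obtain q where "\<And>y n. run (y \<squnion>\<^sub>T w) q n = Some (of_bool (g y n))"
      using g unfolding decidable_def computable_def by blast
    then show ?thesis unfolding computes_def by (intro exI[of _ q] allI conjI impI) auto
  qed
  moreover have "0 < measure uniform {y. f (g y) = y}"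
  proof -
    have "decidable (\<lambda>y. y \<squnion>\<^sub>T w) (\<lambda>y n. f (g y) n \<longleftrightarrow> y n)"
      by (intro decidable_iff decidable_total_computable[OF assms(2) g] decidable_join_left computable_id)
    then have "(\<Inter>n. {y. f (g y) n \<longleftrightarrow> y n}) \<in> sets uniform"
      using sets_decidable by (intro sets.countable_INT) auto
    moreover have "(\<Inter>n. {y. f (g y) n \<longleftrightarrow> y n}) = {y. f (g y) = y}"
      by (auto simp: fun_eq_iff)
    ultimately have sets: "{y. f (g y) = y} \<in> sets uniform" by simp
    have "range f \<subseteq> {y. f (g y) = y} \<union> misled e d"
      using preimage_correct[OF p] unfolding g_def e_def by blast
    then have "measure uniform (range f) \<le> measure uniform ({y. f (g y) = y} \<union> misled e d)"
      using sets sets_misled by (intro uniform.finite_measure_mono) auto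
    also have "\<dots> \<le> measure uniform {y. f (g y) = y} + measure uniform (misled e d)"
      using sets sets_misled by (intro measure_Un_le)
    finally show ?thesis using prob_misled[of e d] d by linarith
  qed
  ultimately show ?thesis
    by (intro exI[of _ "\<lambda>y. Some (g y)"]) (simp add: positive_inversion_def)
qed

section \<open>The equivalence\<close>

theorem corollary2p10:
  fixes w :: cantor
  shows
    "((\<forall>f. total_computable f \<and> measure uniform (range f) > 0 \<longrightarrow>
         (\<exists>g. computes w g \<and> positive_inversion f g))
      \<longleftrightarrow>
      (\<forall>f. total_computable f \<and> measure uniform (range f) > 0 \<longrightarrow>
         (\<exists>g. computes w g \<and> probabilistic_inversion f g)))
     \<and>
     ((\<forall>f. total_computable f \<and> measure uniform (range f) > 0 \<longrightarrow>
         (\<exists>g. computes w g \<and> probabilistic_inversion f g))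
      \<longleftrightarrow>
      halting_problem \<le>\<^sub>T w)"
    (is "(?positive \<longleftrightarrow> ?probabilistic) \<and> (_ \<longleftrightarrow> ?halting)")
proof -
  have "?positive \<Longrightarrow> ?probabilistic"
    using computes_even_part probabilistic_of_positive_inversion by blast
  moreover have "?probabilistic \<Longrightarrow> ?halting"
  proof -
    assume ?probabilistic
    moreover have "0 < measure uniform (range puzzle)"
      unfolding surj_puzzle using uniform.prob_space by simp
    ultimately obtain g where "computes w g" "probabilistic_inversion puzzle g"
      using total_computable_puzzle by blast
    then show ?halting by (rule halting_reducible_of_probabilistic_inversion)
  qed
  moreover have "?halting \<Longrightarrow> ?positive"
    using positive_inversion_of_halting by blast
  ultimately show ?thesis by blast
qed

end
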